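(* Let $\kappa$ be an infinite cardinal, $D$ a tournament with $|V(D)|=\kappa$, and $\mu=\mathrm{cf}(\kappa)$. (i) If every vertex of $D$ has out-degree $<\kappa$, then there are $\mathcal C\in\mathrm{rs}(D)$ and a partition $V(D)=\bigsqcup\{V_\xi:\xi<\mu\}$ with $|V_\xi|<\kappa$ for all $\xi$, such that $uv\in A(D^{\mathcal C})$ whenever $u\in V_\xi$, $v\in V_\zeta$ and $\zeta<\xi$. (ii) If every vertex of $D$ has in-degree $<\kappa$, then there are $\mathcal C\in\mathrm{rs}(D)$ and a partition $V(D)=\bigsqcup\{V_\xi:\xi<\mu\}$ with $|V_\xi|<\kappa$ for all $\xi$, such that $uv\in A(D^{\mathcal C})$ whenever $v\in V_\xi$, $u\in V_\zeta$ and $\zeta<\xi$.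
   Context: A tournament is a digraph (no loops) in which for all distinct $u,v$ exactly one of $uv$, $vu$ is an arc. For a directed cycle $C$, $D^{C}$ is the digraph on $V(D)$ with arc set $(A(D)\setminus A(C))\cup\{vu: uv\in A(C)\}$. Reversal sequences $\mathrm{rs}(D)$ and $D^{\mathcal C}$ are defined by transfinite recursion: (1) $\emptyset\in\mathrm{rs}(D)$, $D^\emptyset=D$; (2) if $\mathcal C\in\mathrm{rs}(D)$ and $C^*$ is a directed cycle of $D^{\mathcal C}$ then $\mathcal C^\frown\langle C^*\rangle\in\mathrm{rs}(D)$ and $D^{\mathcal C^\frown\langle C^*\rangle}=(D^{\mathcal C})^{C^*}$; (3) if $\mathcal C_\xi\in\mathrm{rs}(D)$ ($\xi<\zeta$) is an increasing (end-extending) sequence whose union $\mathcal C$ is locally finite (each edge lies in only finitely many cycles of $\mathcal C$), then $\mathcal C\in\mathrm{rs}(D)$ and $uv\in A(D^{\mathcal C})$ iff for some $\nu<\zeta$, $uv\in A(D^{\mathcal C_\xi})$ for all $\nu<\xi<\zeta$. $\mathrm{cf}(\kappa)$ is the cofinality of $\kappa$. *)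

theory Defs
  imports "Graph_Theory.Pair_Digraph"
begin

unbundle cardinal_syntax

locale tournament = pair_loopfree_digraph D for D :: "'v pair_pre_digraph" +
  assumes exactly_one_arc:
    "u \<in> pverts D \<Longrightarrow> v \<in> pverts D \<Longrightarrow> u \<noteq> v \<Longrightarrow>
      ((u, v) \<in> parcs D) \<noteq> ((v, u) \<in> parcs D)"

text \<open>
  A directed cycle is represented by its set of arcs, so that it does not depend on the
  choice of a starting vertex.
\<close>

definition directed_cycle :: "'v pair_pre_digraph \<Rightarrow> ('v \<times> 'v) set \<Rightarrow> bool" where
  "directed_cycle D C \<longleftrightarrow> (\<exists>p. pre_digraph.cycle (with_proj D) p \<and> C = set p)"

definition reverse_cycle :: "'v pair_pre_digraph \<Rightarrow> ('v \<times> 'v) set \<Rightarrow> 'v pair_pre_digraph" where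
  "reverse_cycle D C = \<lparr>pverts = pverts D, parcs = (parcs D - C) \<union> {(v, u). (u, v) \<in> C}\<rparr>"

text \<open>
  A transfinite sequence of cycles is a pair \<open>(r, s)\<close>: the well-order \<open>r\<close> plays the role
  of the ordinal length, its field is the set of positions, and \<open>s i\<close> is the cycle at
  position \<open>i\<close>. Values of \<open>s\<close> outside the field of \<open>r\<close> are irrelevant.
  Every cycle has an edge and every edge lies in finitely many members of a reversal
  sequence, so reversal sequences of a digraph with an infinite vertex set \<open>V\<close> have
  length below \<open>|V|\<^sup>+\<close>; all of them are represented with vertices as positions.
\<close>

type_synonym ('i, 'v) cycle_seq = "'i rel \<times> ('i \<Rightarrow> ('v \<times> 'v) set)"

definition end_extends :: "('i, 'v) cycle_seq \<Rightarrow> ('i, 'v) cycle_seq \<Rightarrow> bool" where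
  "end_extends c d \<longleftrightarrow>
     fst d initial_segment_of fst c \<and> (\<forall>i \<in> Field (fst d). snd c i = snd d i)"

definition append_cycle ::
  "('i, 'v) cycle_seq \<Rightarrow> 'i \<Rightarrow> ('v \<times> 'v) set \<Rightarrow> ('i, 'v) cycle_seq" where
  "append_cycle c i C =
     (fst c \<union> insert i (Field (fst c)) \<times> {i}, (snd c)(i := C))"

text \<open>Edges are undirected here: a cycle contains the edge between \<open>u\<close> and \<open>v\<close>
  if it uses one of the arcs \<open>uv\<close>, \<open>vu\<close>. Positions are counted, so a cycle
  occurring several times in the sequence counts several times.\<close>

definition locally_finite :: "('i, 'v) cycle_seq \<Rightarrow> bool" where
  "locally_finite c \<longleftrightarrow>
     (\<forall>u v. finite {i \<in> Field (fst c). (u, v) \<in> snd c i \<or> (v, u) \<in> snd c i})"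

text \<open>
  \<open>reversal D c D'\<close> means that \<open>c\<close> is a reversal sequence of \<open>D\<close> and that \<open>D'\<close> is the
  digraph it produces. In the last rule the increasing sequence is \<open>(cs \<xi>)\<close>, where \<open>\<xi>\<close>
  ranges over the field of a well-order \<open>z\<close> of limit type (nonempty, without a last
  element), and \<open>c\<close> is its union. The order \<open>z\<close> may live on the type of positions: the
  length of the union of a strictly increasing sequence is at least the length of that
  sequence.
\<close>

inductive reversal ::
  "'v pair_pre_digraph \<Rightarrow> ('i, 'v) cycle_seq \<Rightarrow> 'v pair_pre_digraph \<Rightarrow> bool"
  for D :: "'v pair_pre_digraph" where
  empty: "reversal D ({}, s) D"
| step: "reversal D (append_cycle c i C) (reverse_cycle D' C)"
    if "reversal D c D'" and "directed_cycle D' C" and "i \<notin> Field (fst c)"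
| limit: "reversal D c
      \<lparr>pverts = pverts D,
       parcs = {(u, v). \<exists>\<nu> \<in> Field z. \<forall>\<xi>. (\<nu>, \<xi>) \<in> z \<and> \<nu> \<noteq> \<xi> \<longrightarrow> (u, v) \<in> parcs (Ds \<xi>)}\<rparr>"
    if "Well_order (z :: 'i rel)" and "z \<noteq> {}" and "\<forall>\<xi> \<in> Field z. \<exists>\<eta>. (\<xi>, \<eta>) \<in> z \<and> \<xi> \<noteq> \<eta>"
      and "\<forall>\<xi> \<in> Field z. reversal D (cs \<xi>) (Ds \<xi>)"
      and "\<forall>\<xi> \<eta>. (\<xi>, \<eta>) \<in> z \<longrightarrow> end_extends (cs \<eta>) (cs \<xi>)"
      and "fst c = (\<Union>\<xi> \<in> Field z. fst (cs \<xi>))"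
      and "\<forall>\<xi> \<in> Field z. \<forall>i \<in> Field (fst (cs \<xi>)). snd c i = snd (cs \<xi>) i"
      and "locally_finite c"

definition rs :: "'v pair_pre_digraph \<Rightarrow> ('i, 'v) cycle_seq set" where
  "rs D = {c. \<exists>D'. reversal D c D'}"

text \<open>For tournaments the result is unique, see \<open>tournament.reversed_eq\<close> below.\<close>

definition reversed :: "'v pair_pre_digraph \<Rightarrow> ('i, 'v) cycle_seq \<Rightarrow> 'v pair_pre_digraph" where
  "reversed D c = (THE D'. reversal D c D')"

text \<open>
  \<open>is_cf \<kappa> \<mu>\<close> says that the cardinal \<open>\<mu>\<close> is the cofinality of the infinite cardinal \<open>\<kappa>\<close>.
  The library notion \<open>cofinal\<close> asks for strict upper bounds, which makes no difference
  for limit ordinals.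
\<close>

definition is_cf :: "'k rel \<Rightarrow> 'm rel \<Rightarrow> bool" where
  "is_cf \<kappa> \<mu> \<longleftrightarrow> Card_order \<mu> \<and>
     (\<exists>K \<subseteq> Field \<kappa>. cofinal K \<kappa> \<and> |K| =o \<mu>) \<and>
     (\<forall>K \<subseteq> Field \<kappa>. cofinal K \<kappa> \<longrightarrow> \<mu> \<le>o |K| )"

definition indexed_partition :: "'v set \<Rightarrow> 'm set \<Rightarrow> ('m \<Rightarrow> 'v set) \<Rightarrow> bool" where
  "indexed_partition A I V \<longleftrightarrow>
     (\<Union>\<xi> \<in> I. V \<xi>) = A \<and> disjoint_family_on V I \<and> (\<forall>\<xi> \<in> I. V \<xi> \<noteq> {})"

context tournament
begin

definition crossings :: "('i, 'v) cycle_seq \<Rightarrow> 'v \<Rightarrow> 'v \<Rightarrow> 'i set" where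
  "crossings c u v = {i \<in> Field (fst c). (u, v) \<in> snd c i \<or> (v, u) \<in> snd c i}"

lemma reversal_parity:
  assumes "reversal D c D'"
  shows "tournament D' \<and> pverts D' = pverts D \<and>
    (\<forall>u\<in>pverts D. \<forall>v\<in>pverts D. u \<noteq> v \<longrightarrow> finite (crossings c u v) \<and>
      ((u, v) \<in> parcs D' \<longleftrightarrow> ((u, v) \<in> parcs D \<longleftrightarrow> even (card (crossings c u v)))))"
  using assms
proof induction
  case (empty s)
  then show ?case by (auto simp: crossings_def tournament_axioms)
next
  case (step c D' C i)
  interpret D': tournament D' using step by blast
  have V: "pverts D' = pverts D" using step by blast
  have C: "C \<subseteq> parcs D'"
    using step(2) unfolding directed_cycle_def D'.cycle_def D'.awalk_def by auto
  let ?D = "reverse_cycle D' C"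
  have anti: "(u, v) \<in> parcs D' \<Longrightarrow> (v, u) \<notin> parcs D'" for u v
    by (metis D'.exactly_one_arc D'.in_arcsD1 D'.in_arcsD2 D'.pair_no_loops fst_conv snd_conv)
  have T: "tournament ?D"
  proof
    fix e assume e: "e \<in> parcs ?D"
    then have "e \<in> parcs D' \<or> (snd e, fst e) \<in> parcs D'"
      using C by (auto simp: reverse_cycle_def)
    then show "fst e \<in> pverts ?D" "snd e \<in> pverts ?D" "fst e \<noteq> snd e"
      using D'.arc_fst_in_verts[of e] D'.arc_snd_in_verts[of e] D'.pair_no_loops[of e]
        D'.in_arcsD1[of "snd e" "fst e"] D'.in_arcsD2[of "snd e" "fst e"]
        D'.pair_no_loops[of "(snd e, fst e)"]
      by (auto simp: reverse_cycle_def)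
  next
    fix u v assume uv: "u \<in> pverts ?D" "v \<in> pverts ?D" "u \<noteq> v"
    then have "((u, v) \<in> parcs D') \<noteq> ((v, u) \<in> parcs D')"
      by (intro D'.exactly_one_arc) (auto simp: reverse_cycle_def)
    then show "((u, v) \<in> parcs ?D) \<noteq> ((v, u) \<in> parcs ?D)"
      using C anti unfolding reverse_cycle_def by auto
  qed
  have F: "Field (fst (append_cycle c i C)) = insert i (Field (fst c))"
    by (auto simp: append_cycle_def Field_def)
  have cr: "crossings (append_cycle c i C) u v =
      (if (u, v) \<in> C \<or> (v, u) \<in> C then insert i (crossings c u v) else crossings c u v)" for u v
    using step(3) unfolding crossings_def F by (auto simp: append_cycle_def)
  have ni: "i \<notin> crossings c u v" for u v using step(3) by (auto simp: crossings_def)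
  show ?case
  proof (intro conjI ballI impI)
    show "tournament ?D" by fact
    show "pverts ?D = pverts D" by (simp add: reverse_cycle_def V)
    fix u v assume uv: "u \<in> pverts D" "v \<in> pverts D" "u \<noteq> v"
    have f: "finite (crossings c u v)"
      and p: "(u, v) \<in> parcs D' \<longleftrightarrow> ((u, v) \<in> parcs D \<longleftrightarrow> even (card (crossings c u v)))"
      using step uv by blast+
    show "finite (crossings (append_cycle c i C) u v)" using f by (simp add: cr)
    have "(u, v) \<in> parcs ?D \<longleftrightarrow>
        ((u, v) \<in> parcs D' \<longleftrightarrow> \<not> ((u, v) \<in> C \<or> (v, u) \<in> C))"
      using C anti by (auto simp: reverse_cycle_def)
    then show "(u, v) \<in> parcs ?D \<longleftrightarrow>
        ((u, v) \<in> parcs D \<longleftrightarrow> even (card (crossings (append_cycle c i C) u v)))"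
      using p f ni by (auto simp: cr)
  qed
next
  case (limit z cs Ds c)
  let ?D = "\<lparr>pverts = pverts D, parcs =
    {(u, v). \<exists>\<nu> \<in> Field z. \<forall>\<xi>. (\<nu>, \<xi>) \<in> z \<and> \<nu> \<noteq> \<xi> \<longrightarrow> (u, v) \<in> parcs (Ds \<xi>)}\<rparr>"
  have refl: "(\<xi>, \<xi>) \<in> z" if "\<xi> \<in> Field z" for \<xi>
    using limit.hyps(1) that by (auto simp: order_on_defs refl_on_def)
  have tot: "(\<xi>, \<eta>) \<in> z \<or> (\<eta>, \<xi>) \<in> z" if "\<xi> \<in> Field z" "\<eta> \<in> Field z" for \<xi> \<eta>
    using limit.hyps(1) that refl by (cases "\<xi> = \<eta>") (auto simp: order_on_defs total_on_def)
  have tr: "(\<xi>, \<eta>) \<in> z \<Longrightarrow> (\<eta>, \<theta>) \<in> z \<Longrightarrow> (\<xi>, \<theta>) \<in> z" for \<xi> \<eta> \<theta>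
    using limit.hyps(1) by (auto simp: order_on_defs dest: transD)
  have asym: "(\<xi>, \<eta>) \<in> z \<Longrightarrow> (\<eta>, \<xi>) \<in> z \<Longrightarrow> \<xi> = \<eta>" for \<xi> \<eta>
    using limit.hyps(1) by (auto simp: order_on_defs antisym_def)
  obtain \<xi>0 where \<xi>0: "\<xi>0 \<in> Field z" using limit.hyps(2) by (auto simp: Field_def)
  have Fc: "Field (fst c) = (\<Union>\<xi> \<in> Field z. Field (fst (cs \<xi>)))"
    unfolding limit.hyps(5) Field_def[of "\<Union>(_ ` _)"] Field_def[of "fst _"] by blast
  have mono: "Field (fst (cs \<xi>)) \<subseteq> Field (fst (cs \<eta>))" if "(\<xi>, \<eta>) \<in> z" for \<xi> \<eta>
    using limit.hyps(4) that mono_Field[of "fst (cs \<xi>)" "fst (cs \<eta>)"]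
    by (simp add: end_extends_def init_seg_of_def)
  have IH: "tournament (Ds \<xi>)" "pverts (Ds \<xi>) = pverts D"
    "u \<in> pverts D \<Longrightarrow> v \<in> pverts D \<Longrightarrow> u \<noteq> v \<Longrightarrow>
      ((u, v) \<in> parcs (Ds \<xi>) \<longleftrightarrow> ((u, v) \<in> parcs D \<longleftrightarrow> even (card (crossings (cs \<xi>) u v))))"
    if "\<xi> \<in> Field z" for \<xi> u v
    using limit.IH that by blast+
  have fin: "finite (crossings c u v)" for u v
    using limit.hyps(7) by (simp add: locally_finite_def crossings_def)
  have sub: "crossings (cs \<xi>) u v = crossings c u v \<inter> Field (fst (cs \<xi>))"
    if "\<xi> \<in> Field z" for \<xi> u v
    using that limit.hyps(6) by (auto simp: crossings_def Fc)
  have cover: "\<exists>\<nu>\<in>Field z. S \<subseteq> Field (fst (cs \<nu>))"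
    if "finite S" "S \<subseteq> Field (fst c)" for S
    using that
  proof induction
    case empty
    then show ?case using \<xi>0 by blast
  next
    case (insert x S)
    then obtain \<nu> \<nu>' where n: "\<nu> \<in> Field z" "S \<subseteq> Field (fst (cs \<nu>))"
      "\<nu>' \<in> Field z" "x \<in> Field (fst (cs \<nu>'))" unfolding Fc by blast
    then show ?case using tot[of \<nu> \<nu>'] mono by blast
  qed
  have par: "(u, v) \<in> parcs ?D \<longleftrightarrow> ((u, v) \<in> parcs D \<longleftrightarrow> even (card (crossings c u v)))"
    if uv: "u \<in> pverts D" "v \<in> pverts D" "u \<noteq> v" for u v
  proof -
    obtain \<nu> where \<nu>: "\<nu> \<in> Field z" "crossings c u v \<subseteq> Field (fst (cs \<nu>))"
      using cover[OF fin] by (metis (no_types, lifting) crossings_def mem_Collect_eq subsetI)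
    define P where "P \<longleftrightarrow> ((u, v) \<in> parcs D \<longleftrightarrow> even (card (crossings c u v)))"
    have ev: "(u, v) \<in> parcs (Ds \<xi>) \<longleftrightarrow> P" if "(\<nu>, \<xi>) \<in> z" for \<xi>
    proof -
      have "\<xi> \<in> Field z" using that by (auto simp: Field_def)
      moreover have "crossings (cs \<xi>) u v = crossings c u v"
        using sub[OF \<open>\<xi> \<in> Field z\<close>] \<nu> mono[OF that] by blast
      ultimately show ?thesis using IH(3)[OF _ uv, of \<xi>] P_def by simp
    qed
    have "(u, v) \<in> parcs ?D \<longleftrightarrow> P"
    proof
      assume P
      then show "(u, v) \<in> parcs ?D" using \<nu> ev by auto
    next
      assume "(u, v) \<in> parcs ?D"
      then obtain \<nu>' where n': "\<nu>' \<in> Field z"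
        "\<And>\<xi>. (\<nu>', \<xi>) \<in> z \<Longrightarrow> \<nu>' \<noteq> \<xi> \<Longrightarrow> (u, v) \<in> parcs (Ds \<xi>)" by auto
      obtain m where m: "m \<in> Field z" "(\<nu>, m) \<in> z" "(\<nu>', m) \<in> z"
        using tot[OF \<nu>(1) n'(1)] refl \<nu>(1) n'(1) by blast
      obtain \<xi> where x: "(m, \<xi>) \<in> z" "m \<noteq> \<xi>" using limit.hyps(3) m by blast
      then have "(\<nu>', \<xi>) \<in> z" "\<nu>' \<noteq> \<xi>" "(\<nu>, \<xi>) \<in> z" using tr m asym by blast+
      then show P using n' ev by blast
    qed
    then show ?thesis by (simp add: P_def)
  qed
  have arc: "\<exists>\<xi>\<in>Field z. e \<in> parcs (Ds \<xi>)" if e: "e \<in> parcs ?D" for e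
  proof -
    obtain \<nu> where n: "\<nu> \<in> Field z" "\<And>\<xi>. (\<nu>, \<xi>) \<in> z \<Longrightarrow> \<nu> \<noteq> \<xi> \<Longrightarrow> e \<in> parcs (Ds \<xi>)"
      using e by (cases e) auto
    obtain \<xi> where "(\<nu>, \<xi>) \<in> z" "\<nu> \<noteq> \<xi>" using limit.hyps(3) n(1) by blast
    then show ?thesis using n(2) FieldI2 by metis
  qed
  have "tournament ?D"
  proof
    fix e assume "e \<in> parcs ?D"
    then obtain \<xi> where x: "\<xi> \<in> Field z" "e \<in> parcs (Ds \<xi>)" using arc by blast
    interpret X: tournament "Ds \<xi>" using IH x by blast
    show "fst e \<in> pverts ?D" "snd e \<in> pverts ?D" "fst e \<noteq> snd e"
      using X.arc_fst_in_verts[OF x(2)] X.arc_snd_in_verts[OF x(2)] X.pair_no_loops[OF x(2)]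
        IH(2)[OF x(1)] by auto
  next
    fix u v assume uv: "u \<in> pverts ?D" "v \<in> pverts ?D" "u \<noteq> v"
    have "crossings c u v = crossings c v u" by (auto simp: crossings_def)
    then show "((u, v) \<in> parcs ?D) \<noteq> ((v, u) \<in> parcs ?D)"
      using par[of u v] par[of v u] exactly_one_arc[of u v] uv by auto
  qed
  moreover have "pverts ?D = pverts D" by simp
  ultimately show ?case using par fin by blast
qed

lemma reversal_unique:
  assumes "reversal D c D1" "reversal D c D2"
  shows "D1 = D2"
proof -
  have T: "tournament D1" "tournament D2" and V: "pverts D1 = pverts D" "pverts D2 = pverts D"
    using assms[THEN reversal_parity] by blast+
  interpret D1: tournament D1 by (rule T)
  interpret D2: tournament D2 by (rule T)
  have "(u, v) \<in> parcs D1 \<longleftrightarrow> (u, v) \<in> parcs D2" for u v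
  proof (cases "u \<in> pverts D \<and> v \<in> pverts D \<and> u \<noteq> v")
    case True
    then show ?thesis using assms[THEN reversal_parity] by blast
  next
    case False
    then show ?thesis
      using V D1.in_arcsD1 D1.in_arcsD2 D1.pair_no_loops[of "(u, v)"]
        D2.in_arcsD1 D2.in_arcsD2 D2.pair_no_loops[of "(u, v)"] by auto
  qed
  then have "parcs D1 = parcs D2" by auto
  then show ?thesis using V by (metis (full_types) pair_pre_digraph.surjective old.unit.exhaust)
qed

lemma reversed_eq: "reversal D c D' \<Longrightarrow> reversed D c = D'"
  unfolding reversed_def using reversal_unique by blast

end

end

theory Submission
  imports Defs
begin

text \<open>
  In both parts it suffices to reach a digraph \<open>D'\<close> in which the vertex set is the union of an
  increasing \<open>\<kappa>\<close>-chain of sets of size less than \<open>\<kappa>\<close> without outgoing arcs; thinning the chain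
  out to length \<open>\<mu>\<close> and taking differences gives the partition. Part (ii) is part (i) for the
  converse digraph.

  If \<open>\<kappa>\<close> is uncountable, let \<open>W a\<close> be the closure of the first \<open>a\<close> vertices of out-degree at most
  \<open>\<lambda> = |a| + \<omega>\<close> under out-neighbours of out-degree at most \<open>\<lambda>\<close>. An arc \<open>uv\<close> leaving \<open>W a\<close> has a
  head with more than \<open>\<lambda>\<close> out-neighbours, so infinitely many fresh vertices \<open>w\<^sub>0, w\<^sub>1, \<dots>\<close> satisfy
  \<open>v \<rightarrow> w\<^sub>n \<rightarrow> u\<close>. Reversing the cycles \<open>u v w\<^sub>0\<close>, \<open>u w\<^sub>0 v w\<^sub>1\<close>, \<open>u w\<^sub>1 v w\<^sub>2\<close>, \<open>\<dots>\<close> one after the other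
  has in the limit the sole effect of reversing \<open>uv\<close>.

  If \<open>\<kappa> = \<omega>\<close>, let \<open>x\<close> be the first vertex that reaches infinitely many vertices. There is a
  geodesic ray \<open>f\<close> from \<open>x\<close>, and reversing the triangles \<open>f 0, f (n + 1), f (n + 2)\<close> one after the
  other reverses exactly the arcs of this ray and lowers the out-degree of \<open>x\<close>. Iterating, every
  vertex is left with a finite reach, which is not touched any more.
\<close>

section \<open>Well-ordered sequences of cycles\<close>

definition crossing :: "('i \<Rightarrow> ('v \<times> 'v) set) \<Rightarrow> 'i set \<Rightarrow> 'v \<Rightarrow> 'v \<Rightarrow> 'i set" where
  "crossing s J u v = {i \<in> J. (u, v) \<in> s i \<or> (v, u) \<in> s i}"

text \<open>Here \<open>k u v\<close> counts how often the edge between \<open>u\<close> and \<open>v\<close> is reversed.\<close>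

definition flipped :: "'v pair_pre_digraph \<Rightarrow> ('v \<Rightarrow> 'v \<Rightarrow> nat) \<Rightarrow> 'v pair_pre_digraph" where
  "flipped D k = \<lparr>pverts = pverts D,
     parcs = {(u, v). u \<in> pverts D \<and> v \<in> pverts D \<and> u \<noteq> v \<and>
       ((u, v) \<in> parcs D \<longleftrightarrow> even (k u v))}\<rparr>"

lemma in_flipped_iff:
  "(u, v) \<in> parcs (flipped D k) \<longleftrightarrow> u \<in> pverts D \<and> v \<in> pverts D \<and> u \<noteq> v \<and>
    ((u, v) \<in> parcs D \<longleftrightarrow> even (k u v))"
  by (simp add: flipped_def)

lemma pverts_flipped [simp]: "pverts (flipped D k) = pverts D"
  by (simp add: flipped_def)

lemma flipped_cong:
  assumes "\<And>u v. even (k u v) \<longleftrightarrow> even (l u v)"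
  shows "flipped D k = flipped D l"
  using assms by (simp add: flipped_def)

lemma reversal_eq_flipped:
  assumes "tournament D" "reversal D (r, s) D'"
  shows "D' = flipped D (\<lambda>u v. card (crossing s (Field r) u v))"
proof -
  interpret tournament D by fact
  have T: "tournament D'" and V: "pverts D' = pverts D"
    and P: "\<And>u v. u \<in> pverts D \<Longrightarrow> v \<in> pverts D \<Longrightarrow> u \<noteq> v \<Longrightarrow>
      (u, v) \<in> parcs D' \<longleftrightarrow> ((u, v) \<in> parcs D \<longleftrightarrow> even (card (crossing s (Field r) u v)))"
    using reversal_parity[OF assms(2)] by (auto simp: crossings_def crossing_def)
  interpret D': tournament D' by (rule T)
  have "(u, v) \<in> parcs D' \<longleftrightarrow>
      (u, v) \<in> parcs (flipped D (\<lambda>u v. card (crossing s (Field r) u v)))" for u v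
  proof (cases "u \<in> pverts D \<and> v \<in> pverts D \<and> u \<noteq> v")
    case True
    then show ?thesis using P by (simp add: flipped_def)
  next
    case False
    then show ?thesis
      using V D'.in_arcsD1 D'.in_arcsD2 D'.pair_no_loops[of "(u, v)"] by (auto simp: flipped_def)
  qed
  then have "parcs D' = parcs (flipped D (\<lambda>u v. card (crossing s (Field r) u v)))" by auto
  then show ?thesis
    using V by (intro pair_pre_digraph.equality) simp_all
qed

lemma reversal_Restr:
  fixes r :: "'i rel"
  assumes T: "tournament D" and r: "Well_order r"
    and fin: "\<And>u v. finite (crossing s (Field r) u v)"
    and cyc: "\<And>i. i \<in> Field r \<Longrightarrow>
      directed_cycle (flipped D (\<lambda>u v. card (crossing s (underS r i) u v))) (s i)"
  shows "reversal D (r, s) (flipped D (\<lambda>u v. card (crossing s (Field r) u v)))"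
proof -
  interpret r: wo_rel r using r by (simp add: wo_rel_def)
  let ?P = "\<lambda>J. \<exists>D'. reversal D (Restr r J, s) D'"
  have FR: "Field (Restr r J) = J" if "r.ofilter J" for J
    using Field_Restr_ofilter[OF r that] .
  have ofS: "r.ofilter (underS r i)" if "i \<in> Field r" for i
    using r.underS_ofilter by simp
  have trans: "(a, b) \<in> r \<Longrightarrow> (b, c) \<in> r \<Longrightarrow> (a, c) \<in> r" for a b c
    using r.TRANS by (auto dest: transD)
  have main: "?P J" if J: "r.ofilter J" and IH: "\<And>i. i \<in> J \<Longrightarrow> ?P (underS r i)" for J
  proof -
    have JF: "J \<subseteq> Field r" and Jd: "\<And>a b. (a, b) \<in> r \<Longrightarrow> b \<in> J \<Longrightarrow> a \<in> J"
      using J by (auto simp: r.ofilter_def under_def)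
    have refl: "(i, i) \<in> r" if "i \<in> J" for i
      using JF that r.REFL by (auto simp: refl_on_def)
    have tot: "(i, j) \<in> r \<or> (j, i) \<in> r" if "i \<in> J" "j \<in> J" for i j
      using JF that refl r.TOTAL by (cases "i = j") (auto simp: total_on_def)
    consider (e) "J = {}" | (m) i where "i \<in> J" "\<And>j. j \<in> J \<Longrightarrow> (j, i) \<in> r"
      | (l) "J \<noteq> {}" "\<And>i. i \<in> J \<Longrightarrow> \<exists>j \<in> J. (j, i) \<notin> r"
      by blast
    then show ?thesis
    proof cases
      case e
      then show ?thesis using reversal.empty[of D s] by auto
    next
      case (m i)
      obtain D' where D': "reversal D (Restr r (underS r i), s) D'" using IH m by blast
      have iF: "i \<in> Field r" using m JF by blast
      have "D' = flipped D (\<lambda>u v. card (crossing s (underS r i) u v))"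
        using reversal_eq_flipped[OF T D'] FR[OF ofS[OF iF]] by simp
      then have c: "directed_cycle D' (s i)" using cyc[OF iF] by simp
      have "reversal D (append_cycle (Restr r (underS r i), s) i (s i)) (reverse_cycle D' (s i))"
        by (rule reversal.step[OF D' c]) (simp add: FR[OF ofS[OF iF]], simp add: underS_def)
      moreover have "append_cycle (Restr r (underS r i), s) i (s i) = (Restr r J, s)"
      proof -
        have "Restr r J = Restr r (underS r i) \<union> insert i (underS r i) \<times> {i}"
        proof -
          have J': "J = insert i (underS r i)" using m Jd by (auto simp: underS_def)
          show ?thesis
            unfolding J' using refl[OF m(1)] r.ANTISYM by (auto simp: underS_def antisym_def)
        qed
        then show ?thesis by (simp add: append_cycle_def FR[OF ofS[OF iF]])
      qed
      ultimately show ?thesis by auto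
    next
      case l
      define z where "z = Restr r J"
      have Fz: "Field z = J" unfolding z_def by (rule FR[OF J])
      have lim: "\<exists>j\<in>J. (i, j) \<in> z \<and> i \<noteq> j" if iJ: "i \<in> J" for i
      proof -
        obtain j where j: "j \<in> J" "(j, i) \<notin> r" using l(2)[OF iJ] by blast
        then have "(i, j) \<in> r" "i \<noteq> j" using tot[OF iJ j(1)] refl[OF iJ] by auto
        then show ?thesis using j(1) iJ unfolding z_def by blast
      qed
      define cs where "cs i = (Restr r (underS r i), s)" for i
      obtain Ds where Ds: "\<And>i. i \<in> J \<Longrightarrow> reversal D (cs i) (Ds i)"
        using IH unfolding cs_def by metis
      have U: "(\<Union>i\<in>J. Restr r (underS r i)) = Restr r J"
      proof
        show "(\<Union>i\<in>J. Restr r (underS r i)) \<subseteq> Restr r J"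
          using Jd by (auto simp: underS_def)
        show "Restr r J \<subseteq> (\<Union>i\<in>J. Restr r (underS r i))"
        proof clarify
          fix a b assume ab: "(a, b) \<in> r" "a \<in> J" "b \<in> J"
          obtain i where i: "i \<in> J" "(b, i) \<in> r" "b \<noteq> i" using lim[OF ab(3)] by (auto simp: z_def)
          have "(a, i) \<in> r" "a \<noteq> i" using ab i trans r.ANTISYM by (auto simp: antisym_def)
          then have "(a, b) \<in> Restr r (underS r i)" using ab i by (auto simp: underS_def)
          then show "(a, b) \<in> (\<Union>i\<in>J. Restr r (underS r i))" using i(1) by blast
        qed
      qed
      have "reversal D (Restr r J, s)
        \<lparr>pverts = pverts D,
         parcs = {(u, v). \<exists>\<nu> \<in> Field z. \<forall>\<xi>. (\<nu>, \<xi>) \<in> z \<and> \<nu> \<noteq> \<xi> \<longrightarrow> (u, v) \<in> parcs (Ds \<xi>)}\<rparr>"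
      proof (rule reversal.limit[where cs = cs])
        show "Well_order z" unfolding z_def using r by (rule Well_order_Restr)
        show "z \<noteq> {}" using l(1) Fz by (auto simp: Field_def)
        show "\<forall>\<xi>\<in>Field z. \<exists>\<eta>. (\<xi>, \<eta>) \<in> z \<and> \<xi> \<noteq> \<eta>" using lim by (auto simp: Fz)
        show "\<forall>\<xi>\<in>Field z. reversal D (cs \<xi>) (Ds \<xi>)" using Ds by (simp add: Fz)
        show "\<forall>\<xi> \<eta>. (\<xi>, \<eta>) \<in> z \<longrightarrow> end_extends (cs \<eta>) (cs \<xi>)"
        proof (intro allI impI)
          fix \<xi> \<eta> assume "(\<xi>, \<eta>) \<in> z"
          then have x: "(\<xi>, \<eta>) \<in> r" by (simp add: z_def)
          have sub: "underS r \<xi> \<subseteq> underS r \<eta>"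
            using x trans r.ANTISYM by (auto simp: underS_def antisym_def)
          have down: "a \<in> underS r \<xi>" if "(a, b) \<in> r" "b \<in> underS r \<xi>" for a b
            using that ofS[of \<xi>] x by (auto simp: r.ofilter_def under_def Field_def)
          have "Restr r (underS r \<xi>) initial_segment_of Restr r (underS r \<eta>)"
            unfolding init_seg_of_def using sub down by simp blast
          then show "end_extends (cs \<eta>) (cs \<xi>)" by (simp add: end_extends_def cs_def)
        qed
        show "fst (Restr r J, s) = (\<Union>\<xi>\<in>Field z. fst (cs \<xi>))"
          using U by (simp add: Fz cs_def)
        show "\<forall>\<xi>\<in>Field z. \<forall>i\<in>Field (fst (cs \<xi>)). snd (Restr r J, s) i = snd (cs \<xi>) i"
          by (simp add: cs_def)
        show "locally_finite (Restr r J, s)"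
          unfolding locally_finite_def fst_conv snd_conv FR[OF J]
        proof (intro allI)
          fix u v
          show "finite {i \<in> J. (u, v) \<in> s i \<or> (v, u) \<in> s i}"
            by (rule finite_subset[OF _ fin[of u v]]) (use JF in \<open>auto simp: crossing_def\<close>)
        qed
      qed
      then show ?thesis by blast
    qed
  qed
  have "?P (underS r i)" if "i \<in> Field r" for i
    using that
  proof (induction i rule: r.well_order_induct)
    case (1 i)
    have "?P (underS r j)" if "j \<in> underS r i" for j
      using that 1 by (auto simp: underS_def Field_def)
    then show ?case using main[OF ofS[OF 1(2)]] by blast
  qed
  then have "?P (Field r)" using main[OF r.Field_ofilter] by blast
  then obtain D' where D': "reversal D (r, s) D'" by (auto simp: Restr_Field)
  then show ?thesis using reversal_eq_flipped[OF T D'] by simp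
qed

lemma reversal_of_well_order:
  fixes D :: "'v pair_pre_digraph" and r :: "'i rel"
  assumes T: "tournament D" and r: "Well_order r" and le: "|Field r| \<le>o |UNIV :: 'v set|"
    and fin: "\<And>u v. finite (crossing s (Field r) u v)"
    and cyc: "\<And>i. i \<in> Field r \<Longrightarrow>
      directed_cycle (flipped D (\<lambda>u v. card (crossing s (underS r i) u v))) (s i)"
  shows "\<exists>c :: ('v, 'v) cycle_seq.
    reversal D c (flipped D (\<lambda>u v. card (crossing s (Field r) u v)))"
proof -
  obtain f :: "'i \<Rightarrow> 'v" where f: "inj_on f (Field r)"
    using le by (auto simp flip: card_of_ordLeq)
  define r' where "r' = dir_image r f"
  define s' where "s' = s \<circ> inv_into (Field r) f"
  have F': "Field r' = f ` Field r" unfolding r'_def by (rule dir_image_Field)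
  have W: "Well_order r'" unfolding r'_def using r f by (rule Well_order_dir_image)
  have cr: "crossing s' (f ` J) u v = f ` crossing s J u v" if "J \<subseteq> Field r" for J u v
    using that f by (auto simp: crossing_def s'_def subset_iff)
  have cd: "card (crossing s' (f ` J) u v) = card (crossing s J u v)" if "J \<subseteq> Field r" for J u v
  proof -
    have "crossing s J u v \<subseteq> Field r" using that by (auto simp: crossing_def)
    then show ?thesis unfolding cr[OF that] using f by (intro card_image) (rule inj_on_subset)
  qed
  have uS: "underS r' (f i) = f ` underS r i" if "i \<in> Field r" for i
  proof
    show "underS r' (f i) \<subseteq> f ` underS r i"
    proof
      fix x assume "x \<in> underS r' (f i)"
      then obtain a b where ab: "x = f a" "f i = f b" "(a, b) \<in> r" "x \<noteq> f i"
        by (auto simp: underS_def r'_def dir_image_def)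
      then have "b = i" using inj_onD[OF f ab(2) that] by (auto simp: Field_def)
      then show "x \<in> f ` underS r i" using ab by (auto simp: underS_def)
    qed
    show "f ` underS r i \<subseteq> underS r' (f i)"
    proof clarify
      fix a assume a: "a \<in> underS r i"
      then have "f a \<noteq> f i" using inj_onD[OF f _ _ that, of a] by (auto simp: underS_def Field_def)
      then show "f a \<in> underS r' (f i)" using a by (auto simp: underS_def r'_def dir_image_def)
    qed
  qed
  have subS: "underS r i \<subseteq> Field r" for i by (auto simp: underS_def Field_def)
  have "reversal D (r', s') (flipped D (\<lambda>u v. card (crossing s' (Field r') u v)))"
  proof (rule reversal_Restr[OF T W])
    show "finite (crossing s' (Field r') u v)" for u v
      unfolding F' cr[OF order_refl] using fin by blast
    fix i assume "i \<in> Field r'"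
    then obtain j where j: "j \<in> Field r" "i = f j" using F' by auto
    have "s' i = s j" using f j by (simp add: s'_def)
    then show "directed_cycle (flipped D (\<lambda>u v. card (crossing s' (underS r' i) u v))) (s' i)"
      using cyc[OF j(1)] by (simp add: j(2) uS[OF j(1)] cd[OF subS])
  qed
  then show ?thesis unfolding F' cd[OF order_refl] by blast
qed

definition lex_product :: "'a rel \<Rightarrow> 'b rel \<Rightarrow> ('a \<times> 'b) rel" where
  "lex_product r s = {((a, m), (b, n)). a \<in> Field r \<and> b \<in> Field r \<and> m \<in> Field s \<and> n \<in> Field s \<and>
    (a \<noteq> b \<and> (a, b) \<in> r \<or> a = b \<and> (m, n) \<in> s)}"

lemma
  assumes r: "Well_order r" and s: "Well_order s"
  shows Field_lex_product: "Field (lex_product r s) = Field r \<times> Field s"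
    and Well_order_lex_product: "Well_order (lex_product r s)"
proof -
  have rs: "Refl r" "Refl s" "trans r" "trans s" "antisym r" "antisym s" "Total r" "Total s"
    "wf (r - Id)" "wf (s - Id)"
    using r s by (auto simp: order_on_defs)
  have refl: "(x, x) \<in> lex_product r s" if "x \<in> Field r \<times> Field s" for x
    using that rs(2) by (auto simp: lex_product_def refl_on_def)
  have sub: "lex_product r s \<subseteq> (Field r \<times> Field s) \<times> (Field r \<times> Field s)"
    by (auto simp: lex_product_def)
  show F: "Field (lex_product r s) = Field r \<times> Field s"
  proof
    show "Field (lex_product r s) \<subseteq> Field r \<times> Field s" using sub mono_Field[OF sub] by (auto simp: Field_def)
    show "Field r \<times> Field s \<subseteq> Field (lex_product r s)" using refl by (blast intro: FieldI1)
  qed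
  have "Refl (lex_product r s)" using refl by (simp add: F refl_on_def)
  moreover have "trans (lex_product r s)"
  proof (rule transI, clarify)
    fix a m b n c k
    assume 1: "((a, m), (b, n)) \<in> lex_product r s" and 2: "((b, n), (c, k)) \<in> lex_product r s"
    have "a = b \<and> (m, n) \<in> s \<or> a \<noteq> b \<and> (a, b) \<in> r" "b = c \<and> (n, k) \<in> s \<or> b \<noteq> c \<and> (b, c) \<in> r"
      using 1 2 by (auto simp: lex_product_def)
    then have "a \<noteq> c \<and> (a, c) \<in> r \<or> a = c \<and> (m, k) \<in> s"
      using transD[OF rs(3)] transD[OF rs(4)] antisymD[OF rs(5)] by metis
    then show "((a, m), (c, k)) \<in> lex_product r s" using 1 2 by (auto simp: lex_product_def)
  qed
  moreover have "antisym (lex_product r s)"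
    by (rule antisymI) (auto simp: lex_product_def dest: antisymD[OF rs(5)] antisymD[OF rs(6)])
  moreover have "Total (lex_product r s)"
    using rs(1,2,7,8) unfolding total_on_def F by (auto simp: lex_product_def refl_on_def)
  moreover have "wf (lex_product r s - Id)"
    by (rule wf_subset[OF wf_lex_prod[OF rs(9,10)]]) (auto simp: lex_product_def)
  ultimately show "Well_order (lex_product r s)"
    using sub by (simp add: order_on_defs F)
qed

lemma underS_lex_product:
  assumes "refl_on (Field s) s" "a \<in> Field r" "m \<in> Field s"
  shows "underS (lex_product r s) (a, m) = underS r a \<times> Field s \<union> {a} \<times> underS s m"
  using assms by (auto simp: underS_def lex_product_def Field_def)

lemma directed_cycleI3:
  assumes "tournament E" "(x, y) \<in> parcs E" "(y, z) \<in> parcs E" "(z, x) \<in> parcs E"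
  shows "directed_cycle E {(x, y), (y, z), (z, x)}"
proof -
  interpret tournament E by fact
  have "x \<noteq> y" "y \<noteq> z" "z \<noteq> x" using assms pair_no_loops by fastforce+
  then show ?thesis
    unfolding directed_cycle_def cycle_def awalk_def using assms in_arcsD1
    by (intro exI[of _ "[(x, y), (y, z), (z, x)]"]) (auto intro!: exI[of _ x])
qed

lemma directed_cycleI4:
  assumes "tournament E" "(x, y) \<in> parcs E" "(y, z) \<in> parcs E" "(z, w) \<in> parcs E" "(w, x) \<in> parcs E"
    and "x \<noteq> z" "y \<noteq> w"
  shows "directed_cycle E {(x, y), (y, z), (z, w), (w, x)}"
proof -
  interpret tournament E by fact
  have "x \<noteq> y" "y \<noteq> z" "z \<noteq> w" "w \<noteq> x" using assms pair_no_loops by fastforce+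
  then show ?thesis
    unfolding directed_cycle_def cycle_def awalk_def using assms in_arcsD1
    by (intro exI[of _ "[(x, y), (y, z), (z, w), (w, x)]"]) (auto intro!: exI[of _ x])
qed

lemma tournament_flipped:
  assumes "tournament D" "\<And>u v. k u v = k v u"
  shows "tournament (flipped D k)"
proof -
  interpret tournament D by fact
  show ?thesis
  proof
    fix e assume "e \<in> parcs (flipped D k)"
    then show "fst e \<in> pverts (flipped D k)" "snd e \<in> pverts (flipped D k)" "fst e \<noteq> snd e"
      by (cases e; simp add: in_flipped_iff)+
  next
    fix u v assume "u \<in> pverts (flipped D k)" "v \<in> pverts (flipped D k)" "u \<noteq> v"
    then show "((u, v) \<in> parcs (flipped D k)) \<noteq> ((v, u) \<in> parcs (flipped D k))"
      using exactly_one_arc[of u v] assms(2)[of u v] by (auto simp: in_flipped_iff)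
  qed
qed

text \<open>
  Every \<open>a\<close> in the field of \<open>z\<close> stands for a block of \<open>\<omega>\<close> cycles. Cycle \<open>n\<close> of the block reverses
  the edges in \<open>H a n\<close> for good and those in \<open>G a n\<close> temporarily: they are restored by cycle
  \<open>n + 1\<close>. The numbers in the last assumption count the reversals before cycle \<open>n\<close> modulo 2.
\<close>

lemma reversal_blocks:
  fixes D :: "'v pair_pre_digraph" and z :: "'a rel" and H G :: "'a \<Rightarrow> nat \<Rightarrow> ('v \<times> 'v) set"
  assumes T: "tournament D" and inf: "infinite (UNIV :: 'v set)"
    and z: "Well_order z" and le: "|Field z| \<le>o |UNIV :: 'v set|"
    and edges: "\<And>a n u v. a \<in> Field z \<Longrightarrow> (u, v) \<in> s a n \<or> (v, u) \<in> s a n \<longleftrightarrow>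
      (u, v) \<in> H a n \<or> (u, v) \<in> G a n \<or> (\<exists>m. n = Suc m \<and> (u, v) \<in> G a m)"
    and disj: "\<And>a n. a \<in> Field z \<Longrightarrow> H a n \<inter> G a n = {}"
      "\<And>a n. a \<in> Field z \<Longrightarrow> H a (Suc n) \<inter> G a n = {}"
      "\<And>a n. a \<in> Field z \<Longrightarrow> G a n \<inter> G a (Suc n) = {}"
    and finH: "\<And>e. finite {(a, n). a \<in> Field z \<and> e \<in> H a n}"
    and finG: "\<And>e. finite {(a, n). a \<in> Field z \<and> e \<in> G a n}"
    and cyc: "\<And>a n. a \<in> Field z \<Longrightarrow> directed_cycle (flipped D (\<lambda>u v.
      card {(b, m). b \<in> underS z a \<and> (u, v) \<in> H b m} + card {m. m < n \<and> (u, v) \<in> H a m} +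
      (if \<exists>m. n = Suc m \<and> (u, v) \<in> G a m then 1 else 0))) (s a n)"
  shows "\<exists>c :: ('v, 'v) cycle_seq.
    reversal D c (flipped D (\<lambda>u v. card {(a, n). a \<in> Field z \<and> (u, v) \<in> H a n}))"
proof -
  define r where "r = lex_product z natLeq"
  have W: "Well_order r" unfolding r_def using z natLeq_Well_order by (rule Well_order_lex_product)
  have F: "Field r = Field z \<times> UNIV"
    unfolding r_def using Field_lex_product[OF z natLeq_Well_order] by (simp add: Field_natLeq)
  have uS: "underS r (a, n) = underS z a \<times> UNIV \<union> {a} \<times> {m. m < n}" if "a \<in> Field z" for a n
    unfolding r_def using that
    using underS_lex_product[of natLeq a z n] natLeq_Refl by (simp add: Field_natLeq natLeq_underS_less)
  have zsub: "underS z a \<subseteq> Field z" and zirr: "a \<notin> underS z a" for a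
    by (auto simp: underS_def Field_def)
  define s' where "s' = (\<lambda>(a, n). s a n)"
  define Hs where "Hs u v = {(a, n). a \<in> Field z \<and> (u, v) \<in> H a n}" for u v
  define Gs where "Gs u v = {(a, n). a \<in> Field z \<and> (u, v) \<in> G a n}" for u v
  define sc where "sc = (\<lambda>(a :: 'a, n). (a, Suc n))"
  have sc_inj: "inj_on sc X" for X by (auto simp: sc_def inj_on_def)
  have sc_iff: "(b, k) \<in> sc ` X \<longleftrightarrow> (\<exists>m. k = Suc m \<and> (b, m) \<in> X)" for b k X
    by (force simp: sc_def)
  have fH: "finite (Hs u v)" and fG: "finite (Gs u v)" for u v
    unfolding Hs_def Gs_def using finH finG by blast+
  have cr: "crossing s' J u v = (Hs u v \<inter> J) \<union> ((Gs u v \<inter> J) \<union> (sc ` Gs u v \<inter> J))"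
    if "J \<subseteq> Field z \<times> UNIV" for J u v
  proof (rule set_eqI, clarify)
    fix a n
    have "(a, n) \<in> sc ` Gs u v \<longleftrightarrow> a \<in> Field z \<and> (\<exists>m. n = Suc m \<and> (u, v) \<in> G a m)"
      by (auto simp: sc_iff Gs_def)
    then show "(a, n) \<in> crossing s' J u v \<longleftrightarrow>
        (a, n) \<in> (Hs u v \<inter> J) \<union> ((Gs u v \<inter> J) \<union> (sc ` Gs u v \<inter> J))"
      using that edges[of a u v n] by (auto simp: crossing_def s'_def Hs_def Gs_def)
  qed
  have cd: "card (crossing s' J u v) =
      card (Hs u v \<inter> J) + (card (Gs u v \<inter> J) + card (sc ` Gs u v \<inter> J))"
    if "J \<subseteq> Field z \<times> UNIV" for J u v
  proof -
    have d1: "Hs u v \<inter> Gs u v = {}" "Hs u v \<inter> sc ` Gs u v = {}" "Gs u v \<inter> sc ` Gs u v = {}"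
      using disj by (fastforce simp: Hs_def Gs_def sc_def)+
    have "card (crossing s' J u v) =
        card (Hs u v \<inter> J) + card ((Gs u v \<inter> J) \<union> (sc ` Gs u v \<inter> J))"
      unfolding cr[OF that] using fH fG d1 by (intro card_Un_disjoint) auto
    also have "card ((Gs u v \<inter> J) \<union> (sc ` Gs u v \<inter> J)) =
        card (Gs u v \<inter> J) + card (sc ` Gs u v \<inter> J)"
      using fG d1 by (intro card_Un_disjoint) auto
    finally show ?thesis .
  qed
  have fin: "finite (crossing s' (Field r) u v)" for u v
    unfolding F cr[OF order_refl] using fH fG by simp
  have total: "even (card (crossing s' (Field r) u v)) \<longleftrightarrow>
      even (card {(a, n). a \<in> Field z \<and> (u, v) \<in> H a n})" for u v
  proof -
    have "Hs u v \<inter> (Field z \<times> UNIV) = Hs u v" "Gs u v \<inter> (Field z \<times> UNIV) = Gs u v"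
      "sc ` Gs u v \<inter> (Field z \<times> UNIV) = sc ` Gs u v"
      by (auto simp: Hs_def Gs_def sc_def)
    then have "card (crossing s' (Field r) u v) = card (Hs u v) + (card (Gs u v) + card (Gs u v))"
      unfolding F cd[OF order_refl] by (simp add: card_image[OF sc_inj])
    then show ?thesis by (simp add: Hs_def)
  qed
  have part: "even (card (crossing s' (underS r (a, n)) u v)) \<longleftrightarrow>
      even (card {(b, m). b \<in> underS z a \<and> (u, v) \<in> H b m} + card {m. m < n \<and> (u, v) \<in> H a m} +
        (if \<exists>m. n = Suc m \<and> (u, v) \<in> G a m then 1 else 0))" if a: "a \<in> Field z" for a n u v
  proof -
    let ?J = "underS r (a, n)"
    let ?X = "Gs u v \<inter> ?J"
    have J: "?J \<subseteq> Field z \<times> UNIV" unfolding uS[OF a] using a zsub by auto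
    have "Hs u v \<inter> ?J = {(b, m). b \<in> underS z a \<and> (u, v) \<in> H b m} \<union>
        Pair a ` {m. m < n \<and> (u, v) \<in> H a m}" (is "_ = ?L \<union> ?R")
      unfolding uS[OF a] using a zsub by (auto simp: Hs_def)
    moreover have "finite ?L" by (rule finite_subset[OF _ fH[of u v]]) (use zsub in \<open>auto simp: Hs_def\<close>)
    moreover have "?L \<inter> ?R = {}" using zirr by auto
    ultimately have cH: "card (Hs u v \<inter> ?J) = card {(b, m). b \<in> underS z a \<and> (u, v) \<in> H b m} +
        card {m. m < n \<and> (u, v) \<in> H a m}"
      by (simp add: card_Un_disjoint card_image inj_on_def)
    have eq: "sc ` Gs u v \<inter> ?J = sc ` (?X - {(a, m) | m. n = Suc m})"
    proof (rule set_eqI, clarify)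
      fix b k
      show "(b, k) \<in> sc ` Gs u v \<inter> ?J \<longleftrightarrow> (b, k) \<in> sc ` (?X - {(a, m) | m. n = Suc m})"
        unfolding sc_iff uS[OF a] using zirr[of a] by (cases k) (auto simp: sc_iff)
    qed
    show ?thesis
    proof (cases "\<exists>m. n = Suc m \<and> (u, v) \<in> G a m")
      case True
      then obtain m where m: "n = Suc m" "(u, v) \<in> G a m" by blast
      have mX: "(a, m) \<in> ?X" unfolding uS[OF a] using m a by (auto simp: Gs_def)
      have "sc ` Gs u v \<inter> ?J = sc ` (?X - {(a, m)})" unfolding eq using m by simp
      then have "card (sc ` Gs u v \<inter> ?J) + 1 = card ?X"
        using mX fG[of u v] card_Suc_Diff1[of ?X "(a, m)"] by (simp add: card_image[OF sc_inj])
      then have "even (k + (card ?X + card (sc ` Gs u v \<inter> ?J))) \<longleftrightarrow> even (k + 1)" for k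
        by (metis even_add even_plus_one_iff)
      then show ?thesis unfolding cd[OF J] cH if_P[OF True] .
    next
      case False
      then have "?X - {(a, m) | m. n = Suc m} = ?X" by (auto simp: Gs_def)
      then have "card (sc ` Gs u v \<inter> ?J) = card ?X"
        unfolding eq by (simp add: card_image[OF sc_inj])
      then show ?thesis unfolding cd[OF J] cH if_not_P[OF False] by simp
    qed
  qed
  have "|Field z \<times> (UNIV :: nat set)| \<le>o |UNIV :: 'v set|"
    using inf le infinite_iff_card_of_nat by (blast intro: card_of_Sigma_ordLeq_infinite)
  then have le': "|Field r| \<le>o |UNIV :: 'v set|" by (simp add: F)
  have "directed_cycle (flipped D (\<lambda>u v. card (crossing s' (underS r i) u v))) (s' i)"
    if i: "i \<in> Field r" for i
  proof -
    obtain a n where an: "i = (a, n)" "a \<in> Field z" using i F by auto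
    show ?thesis
      using cyc[OF an(2), of n] flipped_cong[OF part[OF an(2), of n], of D]
      by (simp add: an(1) s'_def)
  qed
  then have "\<exists>c :: ('v, 'v) cycle_seq.
      reversal D c (flipped D (\<lambda>u v. card (crossing s' (Field r) u v)))"
    by (rule reversal_of_well_order[OF T W le' fin])
  then show ?thesis by (simp only: flipped_cong[OF total, of D])
qed

section \<open>Converse digraphs\<close>

definition converse_digraph :: "'v pair_pre_digraph \<Rightarrow> 'v pair_pre_digraph" where
  "converse_digraph D = \<lparr>pverts = pverts D, parcs = (parcs D)\<inverse>\<rparr>"

lemma converse_digraph_simps [simp]: "pverts (converse_digraph D) = pverts D" "parcs (converse_digraph D) = (parcs D)\<inverse>"
  by (simp_all add: converse_digraph_def)

lemma converse_digraph_idem [simp]: "converse_digraph (converse_digraph D) = D"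
  by (simp add: converse_digraph_def)

lemma tournament_conv:
  assumes "tournament D"
  shows "tournament (converse_digraph D)"
proof -
  interpret tournament D by fact
  show ?thesis
  proof
    fix e assume "e \<in> parcs (converse_digraph D)"
    then show "fst e \<in> pverts (converse_digraph D)" "snd e \<in> pverts (converse_digraph D)" "fst e \<noteq> snd e"
      using in_arcsD1 in_arcsD2 pair_no_loops by (cases e; fastforce)+
  next
    fix u v assume "u \<in> pverts (converse_digraph D)" "v \<in> pverts (converse_digraph D)" "u \<noteq> v"
    then show "((u, v) \<in> parcs (converse_digraph D)) \<noteq> ((v, u) \<in> parcs (converse_digraph D))"
      using exactly_one_arc[of u v] by auto
  qed
qed

lemma pcas_rev_path: "pcas u p v \<Longrightarrow> pcas v (rev_path p) u"
proof (induction p arbitrary: u)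
  case (Cons e p)
  have app: "pcas x (p @ q) y \<longleftrightarrow> (\<exists>w. pcas x p w \<and> pcas w q y)" for x y p and q :: "('a \<times> 'a) list"
    by (induction p arbitrary: x) auto
  show ?case using Cons by (auto simp: app)
qed simp

lemma set_rev_path: "set (rev_path p) = (set p)\<inverse>"
  by (induction p) auto

lemma tl_pawalk_verts: "tl (pawalk_verts u p) = map snd p" if "pcas u p v"
proof -
  have "pawalk_verts u p = u # map snd p"
    using that by (induction p arbitrary: u) auto
  then show ?thesis by simp
qed

lemma directed_cycle_conv:
  assumes "directed_cycle D C"
  shows "directed_cycle (converse_digraph D) (C\<inverse>)"
proof -
  interpret C: pair_pre_digraph "converse_digraph D" .
  interpret pair_pre_digraph D .
  obtain p u where p: "C = set p" "awalk u p u" "distinct (tl (pawalk_verts u p))" "p \<noteq> []"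
    using assms unfolding directed_cycle_def cycle_def by auto
  have c: "pcas u p u" "u \<in> pverts D" "set p \<subseteq> parcs D" using p(2) by (auto simp: awalk_def)
  have shift: "x # map snd q = map fst q @ [y]" if "pcas x q y" for x y and q :: "('a \<times> 'a) list"
    using that by (induction q arbitrary: x) auto
  have d: "distinct (map snd p)" using p(3) tl_pawalk_verts[OF c(1)] by simp
  obtain e q where q: "p = e # q" using p(4) by (cases p) auto
  have e: "fst e = u" "map snd p = map fst q @ [u]"
    using shift[OF c(1)] by (auto simp: q)
  have "distinct (map fst p)" using d unfolding e(2) by (simp add: q e(1))
  moreover have "map snd (rev_path q) = rev (map fst q)" for q :: "('a \<times> 'a) list"
    by (induction q) auto
  ultimately have "distinct (tl (pawalk_verts u (rev_path p)))"
    using tl_pawalk_verts[OF pcas_rev_path[OF c(1)]] by simp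
  moreover have "pcas u (rev_path p) u" using pcas_rev_path[OF c(1)] .
  moreover have "set (rev_path p) \<subseteq> (parcs D)\<inverse>" using c(3) by (auto simp: set_rev_path)
  ultimately show ?thesis
    unfolding directed_cycle_def C.cycle_def C.awalk_def using c p
    by (intro exI[of _ "rev_path p"]) (auto simp: set_rev_path)
qed

lemma reversal_conv:
  assumes "reversal D c D'"
  shows "reversal (converse_digraph D) (fst c, \<lambda>i. (snd c i)\<inverse>) (converse_digraph D')"
  using assms
proof induction
  case (empty s)
  then show ?case using reversal.empty[of "converse_digraph D" "\<lambda>i. (s i)\<inverse>"] by simp
next
  case (step c D' C i)
  have "reversal (converse_digraph D) (append_cycle (fst c, \<lambda>i. (snd c i)\<inverse>) i (C\<inverse>)) (reverse_cycle (converse_digraph D') (C\<inverse>))"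
    by (rule reversal.step) (use step directed_cycle_conv in auto)
  moreover have "append_cycle (fst c, \<lambda>i. (snd c i)\<inverse>) i (C\<inverse>) =
      (fst (append_cycle c i C), \<lambda>j. (snd (append_cycle c i C) j)\<inverse>)"
    by (auto simp: append_cycle_def fun_eq_iff)
  moreover have "reverse_cycle (converse_digraph D') (C\<inverse>) = converse_digraph (reverse_cycle D' C)"
    by (auto simp: reverse_cycle_def converse_digraph_def)
  ultimately show ?case by simp
next
  case (limit z cs Ds c)
  have "reversal (converse_digraph D) (fst c, \<lambda>i. (snd c i)\<inverse>)
    \<lparr>pverts = pverts (converse_digraph D), parcs = {(u, v). \<exists>\<nu>\<in>Field z. \<forall>\<xi>. (\<nu>, \<xi>) \<in> z \<and> \<nu> \<noteq> \<xi> \<longrightarrow>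
      (u, v) \<in> parcs (converse_digraph (Ds \<xi>))}\<rparr>"
  proof (rule reversal.limit[where cs = "\<lambda>\<xi>. (fst (cs \<xi>), \<lambda>i. (snd (cs \<xi>) i)\<inverse>)"])
    show "\<forall>\<xi> \<eta>. (\<xi>, \<eta>) \<in> z \<longrightarrow> end_extends (fst (cs \<eta>), \<lambda>i. (snd (cs \<eta>) i)\<inverse>)
        (fst (cs \<xi>), \<lambda>i. (snd (cs \<xi>) i)\<inverse>)"
      using limit.hyps by (simp add: end_extends_def)
    show "locally_finite (fst c, \<lambda>i. (snd c i)\<inverse>)"
      using limit.hyps by (simp add: locally_finite_def disj_commute)
  qed (use limit in auto)
  then show ?case by (simp add: converse_digraph_def converse_def)
qed

section \<open>From chains to partitions\<close>

lemma exists_partition_of_chain: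
  fixes \<kappa> :: "'k rel" and \<mu> :: "'m rel" and W :: "'k \<Rightarrow> 'v set"
  assumes \<kappa>: "Cinfinite \<kappa>" and cf: "is_cf \<kappa> \<mu>" and P: "|P| =o \<kappa>"
    and mono: "\<And>a b. (a, b) \<in> \<kappa> \<Longrightarrow> W a \<subseteq> W b"
    and small: "\<And>a. a \<in> Field \<kappa> \<Longrightarrow> |W a| <o \<kappa>"
    and cover: "(\<Union>a \<in> Field \<kappa>. W a) = P"
  shows "\<exists>V. indexed_partition P (Field \<mu>) V \<and> (\<forall>\<xi> \<in> Field \<mu>. |V \<xi>| <o \<kappa>) \<and>
    (\<forall>\<xi> \<in> Field \<mu>. \<forall>\<zeta> \<in> underS \<mu> \<xi>. \<exists>a \<in> Field \<kappa>. V \<zeta> \<subseteq> W a \<and> V \<xi> \<inter> W a = {})"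
proof -
  obtain K where \<mu>: "Card_order \<mu>" and K: "K \<subseteq> Field \<kappa>" "cofinal K \<kappa>" "|K| =o \<mu>"
    and least: "\<And>S. S \<subseteq> Field \<kappa> \<Longrightarrow> cofinal S \<kappa> \<Longrightarrow> \<mu> \<le>o |S|"
    using cf by (auto simp: is_cf_def)
  interpret k: wo_rel \<kappa> using \<kappa> by (simp add: wo_rel_def card_order_on_well_order_on)
  interpret m: wo_rel \<mu> using \<mu> by (simp add: wo_rel_def card_order_on_well_order_on)
  have ktot: "(a, b) \<in> \<kappa> \<or> (b, a) \<in> \<kappa>" if "a \<in> Field \<kappa>" "b \<in> Field \<kappa>" for a b
    using that k.TOTALS by blast
  have "|Field \<mu>| =o |K|"
    using card_of_Field_ordIso[OF \<mu>] K(3) ordIso_symmetric ordIso_transitive by blast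
  then obtain e where e: "bij_betw e (Field \<mu>) K" by (auto simp flip: card_of_ordIso)
  define Q where "Q = (\<lambda>(h :: 'm \<Rightarrow> 'k) \<xi> k. \<xi> \<in> Field \<mu> \<longrightarrow>
    k \<in> Field \<kappa> \<and> (e \<xi>, k) \<in> \<kappa> \<and> \<not> W k \<subseteq> (\<Union>\<zeta> \<in> underS \<mu> \<xi>. W (h \<zeta>)))"
  have "\<exists>h. \<forall>\<xi>. Q h \<xi> (h \<xi>)"
  proof (rule dependent_wf_choice[OF m.WF])
    fix f g :: "'m \<Rightarrow> 'k" and \<xi> k
    assume "\<And>\<zeta>. (\<zeta>, \<xi>) \<in> \<mu> - Id \<Longrightarrow> f \<zeta> = g \<zeta>"
    then have "(\<Union>\<zeta> \<in> underS \<mu> \<xi>. W (f \<zeta>)) = (\<Union>\<zeta> \<in> underS \<mu> \<xi>. W (g \<zeta>))"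
      by (intro SUP_cong) (auto simp: underS_def)
    then show "Q f \<xi> k = Q g \<xi> k" by (simp add: Q_def)
  next
    fix \<xi> and f :: "'m \<Rightarrow> 'k"
    assume IH: "\<And>\<zeta>. (\<zeta>, \<xi>) \<in> \<mu> - Id \<Longrightarrow> Q f \<zeta> (f \<zeta>)"
    show "\<exists>k. Q f \<xi> k"
    proof (cases "\<xi> \<in> Field \<mu>")
      case True
      let ?S = "f ` underS \<mu> \<xi>"
      have S: "?S \<subseteq> Field \<kappa>" using IH by (auto simp: Q_def underS_def Field_def)
      have "|?S| \<le>o |underS \<mu> \<xi>|" by (rule card_of_image)
      also have "|underS \<mu> \<xi>| <o \<mu>" using \<mu> True by (rule card_of_underS)
      finally have "\<not> cofinal ?S \<kappa>" using least[OF S] not_ordLess_ordLeq by blast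
      then obtain \<beta> where \<beta>: "\<beta> \<in> Field \<kappa>" "\<And>s. s \<in> ?S \<Longrightarrow> \<beta> = s \<or> (\<beta>, s) \<notin> \<kappa>"
        unfolding cofinal_def by blast
      have "(f \<zeta>, \<beta>) \<in> \<kappa>" if "\<zeta> \<in> underS \<mu> \<xi>" for \<zeta>
        using \<beta>(2)[of "f \<zeta>"] ktot[of "f \<zeta>" \<beta>] S that \<beta>(1) by blast
      then have sub: "(\<Union>\<zeta> \<in> underS \<mu> \<xi>. W (f \<zeta>)) \<subseteq> W \<beta>" using mono by blast
      have "\<not> P \<subseteq> W \<beta>"
      proof
        assume "P \<subseteq> W \<beta>"
        then have "|P| \<le>o |W \<beta>|" by (rule card_of_mono1)
        also note small[OF \<beta>(1)]
        also note ordIso_symmetric[OF P]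
        finally show False using ordLess_irreflexive by blast
      qed
      then obtain \<gamma> x where \<gamma>: "\<gamma> \<in> Field \<kappa>" "x \<in> W \<gamma>" "x \<notin> W \<beta>" using cover by blast
      have e\<xi>: "e \<xi> \<in> Field \<kappa>" using e True K(1) by (auto simp: bij_betw_def)
      obtain k where k: "k \<in> Field \<kappa>" "(e \<xi>, k) \<in> \<kappa>" "(\<gamma>, k) \<in> \<kappa>"
        using ktot[OF e\<xi> \<gamma>(1)] ktot[OF e\<xi> e\<xi>] ktot[OF \<gamma>(1) \<gamma>(1)] e\<xi> \<gamma>(1) by blast
      have "x \<in> W k" "x \<notin> (\<Union>\<zeta> \<in> underS \<mu> \<xi>. W (f \<zeta>))"
        using \<gamma>(2,3) sub mono[OF k(3)] by blast+
      then show ?thesis using k(1,2) unfolding Q_def by blast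
    qed (simp add: Q_def)
  qed
  then obtain h where h: "\<And>\<xi>. \<xi> \<in> Field \<mu> \<Longrightarrow> h \<xi> \<in> Field \<kappa>"
    "\<And>\<xi>. \<xi> \<in> Field \<mu> \<Longrightarrow> (e \<xi>, h \<xi>) \<in> \<kappa>"
    "\<And>\<xi>. \<xi> \<in> Field \<mu> \<Longrightarrow> \<not> W (h \<xi>) \<subseteq> (\<Union>\<zeta> \<in> underS \<mu> \<xi>. W (h \<zeta>))"
    unfolding Q_def by metis
  define V where "V \<xi> = W (h \<xi>) - (\<Union>\<zeta> \<in> underS \<mu> \<xi>. W (h \<zeta>))" for \<xi>
  have uS: "underS \<mu> \<xi> \<subseteq> Field \<mu>" for \<xi> by (auto simp: underS_def Field_def)
  have "(\<Union>\<xi> \<in> Field \<mu>. V \<xi>) = P"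
  proof
    show "(\<Union>\<xi> \<in> Field \<mu>. V \<xi>) \<subseteq> P" using h(1) cover by (auto simp: V_def)
    show "P \<subseteq> (\<Union>\<xi> \<in> Field \<mu>. V \<xi>)"
    proof
      fix x assume "x \<in> P"
      then obtain a where a: "a \<in> Field \<kappa>" "x \<in> W a" using cover by blast
      then obtain k where k: "k \<in> K" "(a, k) \<in> \<kappa>" using K(2) by (auto simp: cofinal_def)
      then obtain \<xi>0 where \<xi>0: "\<xi>0 \<in> Field \<mu>" "e \<xi>0 = k" using e by (auto simp: bij_betw_def)
      then have x0: "\<xi>0 \<in> {\<xi> \<in> Field \<mu>. x \<in> W (h \<xi>)}"
        using a(2) mono[OF k(2)] mono[OF h(2)[OF \<xi>0(1)]] by auto
      obtain \<xi> where "\<xi> \<in> {\<xi> \<in> Field \<mu>. x \<in> W (h \<xi>)}"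
        "\<And>\<zeta>. (\<zeta>, \<xi>) \<in> \<mu> - Id \<Longrightarrow> \<zeta> \<notin> {\<xi> \<in> Field \<mu>. x \<in> W (h \<xi>)}"
        using wfE_min[OF m.WF x0] by blast
      then have "x \<in> V \<xi>" "\<xi> \<in> Field \<mu>" using uS by (auto simp: V_def underS_def Field_def)
      then show "x \<in> (\<Union>\<xi> \<in> Field \<mu>. V \<xi>)" by blast
    qed
  qed
  moreover have "disjoint_family_on V (Field \<mu>)"
  proof (unfold disjoint_family_on_def, intro ballI impI)
    fix \<xi> \<zeta> assume "\<xi> \<in> Field \<mu>" "\<zeta> \<in> Field \<mu>" "\<xi> \<noteq> \<zeta>"
    then have "\<xi> \<in> underS \<mu> \<zeta> \<or> \<zeta> \<in> underS \<mu> \<xi>" using m.TOTALS by (auto simp: underS_def)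
    then show "V \<xi> \<inter> V \<zeta> = {}" by (auto simp: V_def)
  qed
  moreover have "\<forall>\<xi> \<in> Field \<mu>. V \<xi> \<noteq> {}" using h(3) by (auto simp: V_def)
  moreover have "|V \<xi>| <o \<kappa>" if "\<xi> \<in> Field \<mu>" for \<xi>
    by (rule ordLeq_ordLess_trans[OF card_of_mono1 small[OF h(1)[OF that]]]) (auto simp: V_def)
  moreover have "\<exists>a \<in> Field \<kappa>. V \<zeta> \<subseteq> W a \<and> V \<xi> \<inter> W a = {}"
    if "\<xi> \<in> Field \<mu>" "\<zeta> \<in> underS \<mu> \<xi>" for \<xi> \<zeta>
    using that h(1)[of \<zeta>] uS[of \<xi>] by (intro bexI[of _ "h \<zeta>"]) (auto simp: V_def)
  ultimately show ?thesis unfolding indexed_partition_def by blast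
qed

section \<open>Uncountable tournaments\<close>

lemma card_of_Un_ordLeq_infinite_set:
  assumes "infinite B" "|X| \<le>o |B|" "|Y| \<le>o |B|"
  shows "|X \<union> Y| \<le>o |B|"
  by (rule card_of_Un_ordLeq_infinite_Field) (use assms in \<open>simp_all add: Field_card_of card_of_card_order_on\<close>)

text \<open>The cardinality of \<open>L a\<close> serves as the bound \<open>|a| + \<omega>\<close>.\<close>

lemma exists_degree_chain:
  fixes \<kappa> :: "'k rel" and N :: "'v \<Rightarrow> 'v set"
  assumes \<kappa>: "Cinfinite \<kappa>" and unc: "natLeq <o \<kappa>" and P: "|P| =o \<kappa>"
    and N: "\<And>v. v \<in> P \<Longrightarrow> N v \<subseteq> P" and deg: "\<And>v. v \<in> P \<Longrightarrow> |N v| <o \<kappa>"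
  obtains L :: "'k \<Rightarrow> ('k + nat) set" and W :: "'k \<Rightarrow> 'v set" where
    "\<And>a. infinite (L a)" "\<And>a. a \<in> Field \<kappa> \<Longrightarrow> |L a| <o \<kappa>"
    "\<And>a. |W a| \<le>o |L a|"
    "\<And>a u. u \<in> W a \<Longrightarrow> |N u| \<le>o |L a|"
    "\<And>a u v. u \<in> W a \<Longrightarrow> v \<in> N u \<Longrightarrow> |N v| \<le>o |L a| \<Longrightarrow> v \<in> W a"
    "\<And>a b. (a, b) \<in> \<kappa> \<Longrightarrow> W a \<subseteq> W b"
    "(\<Union>a \<in> Field \<kappa>. W a) = P"
proof -
  interpret k: wo_rel \<kappa> using \<kappa> by (simp add: wo_rel_def card_order_on_well_order_on)
  have inf: "infinite (Field \<kappa>)" and co: "Card_order \<kappa>" using \<kappa> by (auto simp: cinfinite_def)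
  have "|Field \<kappa>| =o |P|"
    using card_of_Field_ordIso[OF co] P ordIso_symmetric ordIso_transitive by blast
  then obtain e where e: "bij_betw e (Field \<kappa>) P" by (auto simp flip: card_of_ordIso)
  define L where "L a = under \<kappa> a <+> (UNIV :: nat set)" for a
  define B where "B a = {e x | x. x \<in> under \<kappa> a \<and> |N (e x)| \<le>o |L a|}" for a
  define R where "R a = {(u, v). v \<in> N u \<and> |N v| \<le>o |L a|}" for a
  define W where "W a = (R a)\<^sup>* `` B a" for a
  have inL: "infinite (L a)" for a by (simp add: L_def)
  have uF: "under \<kappa> a \<subseteq> Field \<kappa>" for a by (auto simp: under_def Field_def)
  have um: "under \<kappa> a \<subseteq> under \<kappa> b" if "(a, b) \<in> \<kappa>" for a b
    using that k.TRANS by (auto simp: under_def dest: transD)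
  have Lm: "|L a| \<le>o |L b|" if "(a, b) \<in> \<kappa>" for a b
    unfolding L_def using um[OF that] by (intro card_of_mono1) auto
  have uL: "|under \<kappa> a| <o \<kappa>" if a: "a \<in> Field \<kappa>" for a
  proof -
    obtain b where b: "b \<in> Field \<kappa>" "a \<noteq> b" "(a, b) \<in> \<kappa>"
      using infinite_Card_order_limit[OF co inf a] by blast
    have "under \<kappa> a \<subseteq> underS \<kappa> b"
      using b k.TRANS k.ANTISYM by (auto simp: under_def underS_def dest: transD antisymD)
    then show ?thesis using card_of_mono1 card_of_underS[OF co b(1)] ordLeq_ordLess_trans by blast
  qed
  have LK: "|L a| <o \<kappa>" if a: "a \<in> Field \<kappa>" for a
    unfolding L_def
    by (rule card_of_Plus_ordLess_infinite_Field[OF inf co uL[OF a]])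
      (rule ordIso_ordLess_trans[OF card_of_nat unc])
  have BP: "B a \<subseteq> P" for a using e uF by (auto simp: B_def bij_betw_def)
  have Wd: "u \<in> P \<and> |N u| \<le>o |L a|" if u: "u \<in> W a" for u a
  proof -
    obtain x where x: "x \<in> B a" "(x, u) \<in> (R a)\<^sup>*" using u by (auto simp: W_def)
    have x1: "x \<in> P \<and> |N x| \<le>o |L a|" using x(1) BP by (auto simp: B_def)
    show ?thesis using x(2) by (induction) (use x1 N in \<open>auto simp: R_def\<close>)
  qed
  have BL: "|B a| \<le>o |L a|" for a
  proof -
    have "B a \<subseteq> e ` under \<kappa> a" by (auto simp: B_def)
    then have "|B a| \<le>o |under \<kappa> a|" using card_of_mono1 card_of_image ordLeq_transitive by blast
    then show ?thesis unfolding L_def using card_of_Plus1 ordLeq_transitive by blast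
  qed
  have step: "|(R a ^^ n) `` B a| \<le>o |L a|" for a n
  proof (induction n)
    case 0
    then show ?case using BL by simp
  next
    case (Suc n)
    have sub: "(R a ^^ n) `` B a \<subseteq> W a" by (auto simp: W_def dest: relpow_imp_rtrancl)
    have "(R a ^^ Suc n) `` B a \<subseteq> (\<Union>u \<in> (R a ^^ n) `` B a. N u)" by (auto simp: R_def)
    moreover have "|\<Union>u \<in> (R a ^^ n) `` B a. N u| \<le>o |L a|"
      using Wd sub by (intro card_of_UNION_ordLeq_infinite[OF inL Suc]) blast
    ultimately show ?case using card_of_mono1 ordLeq_transitive by blast
  qed
  have nL: "|UNIV :: nat set| \<le>o |L a|" for a using inL by (simp flip: infinite_iff_card_of_nat)
  have WL: "|W a| \<le>o |L a|" for a
  proof -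
    have "W a = (\<Union>n \<in> UNIV. (R a ^^ n) `` B a)"
      unfolding W_def rtrancl_is_UN_relpow by blast
    then show ?thesis using step nL inL by (simp only:) (intro card_of_UNION_ordLeq_infinite, auto)
  qed
  have Wc: "v \<in> W a" if "u \<in> W a" "v \<in> N u" "|N v| \<le>o |L a|" for a u v
    using that by (auto simp: W_def R_def intro: rtrancl_into_rtrancl)
  have Wm: "W a \<subseteq> W b" if "(a, b) \<in> \<kappa>" for a b
  proof -
    have "R a \<subseteq> R b" "B a \<subseteq> B b"
      using Lm[OF that] um[OF that] by (auto simp: R_def B_def intro: ordLeq_transitive)
    then show ?thesis unfolding W_def by (intro Image_mono rtrancl_mono)
  qed
  have "(\<Union>a \<in> Field \<kappa>. W a) = P"
  proof
    show "(\<Union>a \<in> Field \<kappa>. W a) \<subseteq> P" using Wd by blast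
    show "P \<subseteq> (\<Union>a \<in> Field \<kappa>. W a)"
    proof
      fix v assume v: "v \<in> P"
      then obtain x where x: "x \<in> Field \<kappa>" "v = e x" using e by (auto simp: bij_betw_def)
      obtain a where a: "a \<in> Field \<kappa>" "|N v| =o Restr \<kappa> (underS \<kappa> a)"
        using deg[OF v] ordLess_iff_ordIso_Restr[OF k.WELL card_of_Well_order] by blast
      have "|N v| \<le>o |underS \<kappa> a|"
      proof -
        have "|N v| =o |Field (Restr \<kappa> (underS \<kappa> a))|"
          using card_of_cong[OF a(2)] by (simp add: Field_card_of)
        moreover have "Field (Restr \<kappa> (underS \<kappa> a)) \<subseteq> underS \<kappa> a" by (rule Field_Restr_subset)
        ultimately show ?thesis using card_of_mono1 ordIso_ordLeq_trans by blast
      qed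
      moreover obtain b where b: "b \<in> Field \<kappa>" "(a, b) \<in> \<kappa>" "(x, b) \<in> \<kappa>"
        using k.TOTALS a(1) x(1) k.REFL unfolding refl_on_def by metis
      moreover have "underS \<kappa> a \<subseteq> under \<kappa> b" using um[OF b(2)] by (auto simp: under_def underS_def)
      ultimately have "|N v| \<le>o |under \<kappa> b|" using card_of_mono1 ordLeq_transitive by blast
      then have "|N v| \<le>o |L b|" unfolding L_def using card_of_Plus1 ordLeq_transitive by blast
      then have "v \<in> B b" using b x by (auto simp: B_def under_def)
      then have "v \<in> W b" by (auto simp: W_def)
      then show "v \<in> (\<Union>a \<in> Field \<kappa>. W a)" using b by blast
    qed
  qed
  then show thesis using that[of L W] inL LK WL Wd Wc Wm by blast
qed

definition out_nbrs :: "'v pair_pre_digraph \<Rightarrow> 'v \<Rightarrow> 'v set" where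
  "out_nbrs D v = {w. (v, w) \<in> parcs D}"

lemma exists_closed_chain_uncountable:
  fixes \<kappa> :: "'k rel" and D :: "'v pair_pre_digraph"
  assumes T: "tournament D" and \<kappa>: "Cinfinite \<kappa>" and unc: "natLeq <o \<kappa>"
    and P: "|pverts D| =o \<kappa>" and deg: "\<And>v. v \<in> pverts D \<Longrightarrow> |out_nbrs D v| <o \<kappa>"
  shows "\<exists>(c :: ('v, 'v) cycle_seq) D' W. reversal D c D' \<and>
    (\<forall>a b. (a, b) \<in> \<kappa> \<longrightarrow> W a \<subseteq> W b) \<and> (\<forall>a \<in> Field \<kappa>. |W a| <o \<kappa>) \<and>
    (\<Union>a \<in> Field \<kappa>. W a) = pverts D \<and>
    (\<forall>a \<in> Field \<kappa>. \<forall>u \<in> W a. \<forall>v. (u, v) \<in> parcs D' \<longrightarrow> v \<in> W a)"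
proof -
  interpret tournament D by (rule T)
  interpret k: wo_rel \<kappa> using \<kappa> by (simp add: wo_rel_def card_order_on_well_order_on)
  let ?P = "pverts D" and ?N = "out_nbrs D"
  have NP: "?N v \<subseteq> ?P" for v using in_arcsD2 by (auto simp: out_nbrs_def)
  have infP: "infinite ?P"
    using \<kappa> ordIso_symmetric[OF P] card_of_ordIso_finite_Field unfolding cinfinite_def by blast
  have anti: "(v, u) \<notin> parcs D" if "(u, v) \<in> parcs D" for u v
    using that exactly_one_arc in_arcsD1 in_arcsD2 pair_no_loops by (metis fst_conv snd_conv)
  obtain L :: "'k \<Rightarrow> ('k + nat) set" and W where L: "\<And>a. infinite (L a)"
    "\<And>a. a \<in> Field \<kappa> \<Longrightarrow> |L a| <o \<kappa>"
    and WL: "\<And>a. |W a| \<le>o |L a|"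
    and Wdeg: "\<And>a u. u \<in> W a \<Longrightarrow> |?N u| \<le>o |L a|"
    and Wcl: "\<And>a u v. u \<in> W a \<Longrightarrow> v \<in> ?N u \<Longrightarrow> |?N v| \<le>o |L a| \<Longrightarrow> v \<in> W a"
    and Wm: "\<And>a b. (a, b) \<in> \<kappa> \<Longrightarrow> W a \<subseteq> W b"
    and WU: "(\<Union>a \<in> Field \<kappa>. W a) = ?P"
    using exists_degree_chain[where N = "?N", OF \<kappa> unc P NP deg] by blast
  have "\<exists>a. a \<in> Field \<kappa> \<and> u \<in> W a \<and> (\<forall>b \<in> Field \<kappa>. u \<in> W b \<longrightarrow> (a, b) \<in> \<kappa>)" if "u \<in> ?P" for u
  proof -
    let ?S = "{a \<in> Field \<kappa>. u \<in> W a}"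
    have "?S \<noteq> {}" using that WU by blast
    then have "k.isMinim ?S (k.minim ?S)" by (intro k.minim_isMinim) auto
    then show ?thesis unfolding k.isMinim_def by blast
  qed
  then obtain \<rho> where \<rho>: "\<And>u. u \<in> ?P \<Longrightarrow> \<rho> u \<in> Field \<kappa>" "\<And>u. u \<in> ?P \<Longrightarrow> u \<in> W (\<rho> u)"
    "\<And>u b. u \<in> ?P \<Longrightarrow> b \<in> Field \<kappa> \<Longrightarrow> u \<in> W b \<Longrightarrow> (\<rho> u, b) \<in> \<kappa>"
    by metis
  \<comment> \<open>The arcs to be reversed are ordered by the rank \<open>\<rho> u\<close> of their tails. This bounds the number
    of predecessors of an arc \<open>uv\<close> by \<open>|L (\<rho> u)|\<close>, and the arcs \<open>vw\<close> used for \<open>uv\<close> come later.\<close>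
  define bad where "bad = {(u, v). (u, v) \<in> parcs D \<and> v \<notin> W (\<rho> u)}"
  define A where "A = (\<lambda>(u, v). (\<rho> u, (u, v))) ` bad"
  define z where "z = Restr (lex_product \<kappa> |UNIV :: ('v \<times> 'v) set| ) A"
  have A_iff: "(a, (u, v)) \<in> A \<longleftrightarrow> a = \<rho> u \<and> (u, v) \<in> parcs D \<and> v \<notin> W a" for a u v
    by (auto simp: A_def bad_def)
  have lx: "Well_order (lex_product \<kappa> |UNIV :: ('v \<times> 'v) set| )"
    by (rule Well_order_lex_product[OF k.WELL card_of_Well_order])
  have Wz: "Well_order z" unfolding z_def using lx by (rule Well_order_Restr)
  have Fz: "Field z = A"
  proof -
    have "A \<subseteq> Field (lex_product \<kappa> |UNIV :: ('v \<times> 'v) set| )"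
      using \<rho>(1) in_arcsD1 by (auto simp: Field_lex_product[OF k.WELL card_of_Well_order] Field_card_of A_def bad_def)
    then show ?thesis unfolding z_def using lx by (intro Refl_Field_Restr2) (auto simp: order_on_defs)
  qed
  have pred: "b \<in> A \<and> (fst b, fst a) \<in> \<kappa>" if "b = a \<and> a \<in> A \<or> b \<in> underS z a" for a b
  proof -
    have "(x, x) \<in> \<kappa>" if "x \<in> Field \<kappa>" for x using that k.REFL by (simp add: refl_on_def)
    then show ?thesis
      using that \<rho>(1) in_arcsD1 by (auto simp: underS_def z_def lex_product_def A_def bad_def)
  qed
  define r where "r = lex_product z natLeq"
  have Wr: "Well_order r" unfolding r_def using Wz natLeq_Well_order by (rule Well_order_lex_product)
  have wfr: "wf (r - Id)" using Wr by (simp add: well_order_on_def)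
  have Fr: "Field r = A \<times> UNIV"
    unfolding r_def using Field_lex_product[OF Wz natLeq_Well_order] by (simp add: Field_natLeq Fz)
  have r_pred: "fst j = fst i \<and> fst i \<in> A \<or> fst j \<in> underS z (fst i)" if "j \<in> underS r i" for i j
    using that by (cases i; cases j) (auto simp: underS_def r_def lex_product_def Fz)
  define Q where "Q = (\<lambda>(w :: ('k \<times> 'v \<times> 'v) \<times> nat \<Rightarrow> 'v) i x. fst i \<in> A \<longrightarrow>
    (case fst i of (a, (u, v)) \<Rightarrow> x \<in> ?N v - ?N u - W a) \<and> x \<notin> w ` underS r i)"
  have "\<exists>w. \<forall>i. Q w i (w i)"
  proof (rule dependent_wf_choice[OF wfr])
    fix f g :: "('k \<times> 'v \<times> 'v) \<times> nat \<Rightarrow> 'v" and i x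
    assume "\<And>j. (j, i) \<in> r - Id \<Longrightarrow> f j = g j"
    then have "f ` underS r i = g ` underS r i"
      by (intro image_cong) (auto simp: underS_def)
    then show "Q f i x = Q g i x" by (simp add: Q_def)
  next
    fix i :: "('k \<times> 'v \<times> 'v) \<times> nat" and f :: "('k \<times> 'v \<times> 'v) \<times> nat \<Rightarrow> 'v"
    obtain a u v n where i: "i = ((a, (u, v)), n)" by (metis surj_pair)
    show "\<exists>x. Q f i x"
    proof (cases "(a, (u, v)) \<in> A")
      case True
      then have a: "a = \<rho> u" "v \<in> ?N u" "v \<notin> W a" by (auto simp: A_iff out_nbrs_def)
      have u: "u \<in> W a" using a \<rho>(2) in_arcsD1 by (auto simp: out_nbrs_def)
      let ?S = "SIGMA x : W a. ?N x"
      have "underS r i \<subseteq> (\<lambda>(p, m). ((\<rho> (fst p), p), m)) ` (?S \<times> (UNIV :: nat set))"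
      proof
        fix j assume j: "j \<in> underS r i"
        obtain b x y m where jj: "j = ((b, (x, y)), m)" by (metis surj_pair)
        have bA: "(b, (x, y)) \<in> A \<and> (b, a) \<in> \<kappa>" using pred[OF r_pred[OF j]]
          unfolding i jj by auto
        then have x: "y \<in> ?N x" "b = \<rho> x" "x \<in> ?P"
          using in_arcsD1 by (auto simp: A_iff out_nbrs_def)
        then have "x \<in> W a" using \<rho>(2) Wm bA by blast
        with x show "j \<in> (\<lambda>(p, m). ((\<rho> (fst p), p), m)) ` (?S \<times> (UNIV :: nat set))"
          unfolding jj by force
      qed
      then have "|underS r i| \<le>o |?S \<times> (UNIV :: nat set)|"
        using card_of_mono1 card_of_image ordLeq_transitive by blast
      also have "|?S \<times> (UNIV :: nat set)| \<le>o |L a|"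
        using L(1) WL Wdeg infinite_iff_card_of_nat
        by (intro card_of_Sigma_ordLeq_infinite) blast+
      finally have "|f ` underS r i| \<le>o |L a|" using card_of_image ordLeq_transitive by blast
      then have "|?N u \<union> (W a \<union> f ` underS r i)| \<le>o |L a|"
        using L(1) WL Wdeg[OF u] by (intro card_of_Un_ordLeq_infinite_set)
      moreover have "\<not> |?N v| \<le>o |L a|" using Wcl[OF u a(2)] a(3) by blast
      ultimately have "\<not> ?N v \<subseteq> ?N u \<union> (W a \<union> f ` underS r i)"
        using card_of_mono1 ordLeq_transitive by blast
      then show ?thesis by (auto simp: Q_def i)
    qed (simp add: Q_def i)
  qed
  then obtain w0 where w0: "\<And>i. Q w0 i (w0 i)" by blast
  define w where "w a n = w0 (a, n)" for a n
  have w: "w (a, (u, v)) n \<in> ?N v" "w (a, (u, v)) n \<notin> ?N u" "w (a, (u, v)) n \<notin> W a"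
    if "(a, (u, v)) \<in> A" for a u v n
    using w0[of "((a, (u, v)), n)"] that by (auto simp: Q_def w_def)
  have w_inj: "a = b \<and> m = n" if "a \<in> A" "b \<in> A" "w a m = w b n" for a b m n
  proof (rule ccontr)
    assume "\<not> (a = b \<and> m = n)"
    then have "(a, m) \<in> underS r (b, n) \<or> (b, n) \<in> underS r (a, m)"
      using wo_rel.TOTALS[of r] Wr that(1,2) Fr by (auto simp: wo_rel_def underS_def)
    moreover have "w0 i \<notin> w0 ` underS r i" if "fst i \<in> A" for i
      using w0[of i] that by (simp add: Q_def)
    ultimately show False using that unfolding w_def by (metis fst_conv imageI)
  qed
  define H where "H = (\<lambda>(a :: 'k, (u :: 'v, v)) n. if n = (0 :: nat) then {(u, v), (v, u)} else {})"
  define G where "G = (\<lambda>(a, (u, v)) n. let x = w (a, (u, v)) n in {(u, x), (x, u), (v, x), (x, v)})"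
  define s where "s = (\<lambda>(a, (u, v)) n. case n of
      0 \<Rightarrow> (let x = w (a, (u, v)) 0 in {(u, v), (v, x), (x, u)})
    | Suc m \<Rightarrow> (let x = w (a, (u, v)) m; y = w (a, (u, v)) n in {(u, x), (x, v), (v, y), (y, u)}))"
  have nes: "u \<noteq> v \<and> w (a, (u, v)) n \<noteq> u \<and> w (a, (u, v)) n \<noteq> v"
    if "(a, (u, v)) \<in> A" for a u v n
    using w[OF that, of n] that \<rho>(2) in_arcsD1 pair_no_loops by (fastforce simp: A_iff out_nbrs_def)
  have H_iff: "(x, y) \<in> H b m \<longleftrightarrow> m = 0 \<and> (snd b = (x, y) \<or> snd b = (y, x))" for x y b m
    by (cases b) (auto simp: H_def)
  have edge: "b = (\<rho> x, (x, y)) \<and> (x, y) \<in> bad \<or> b = (\<rho> y, (y, x)) \<and> (y, x) \<in> bad"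
    if "b \<in> A" "(x, y) \<in> H b m" for b x y m
    using that by (auto simp: H_iff A_def)
  have late: "(\<rho> x, a) \<notin> \<kappa> \<and> W a \<subseteq> W (\<rho> x)" if "a \<in> Field \<kappa>" "x \<notin> W a" "x \<in> ?P" for a x
  proof -
    have 1: "(\<rho> x, a) \<notin> \<kappa>" using Wm \<rho>(2) that by blast
    then have "(a, \<rho> x) \<in> \<kappa>" using k.TOTALS that \<rho>(1) by blast
    then show ?thesis using 1 Wm by blast
  qed
  have AF: "a \<in> Field \<kappa> \<and> u \<in> W a \<and> u \<in> ?P \<and> v \<in> ?P" if "(a, (u, v)) \<in> A" for a u v
    using that \<rho>(1,2) in_arcsD1 in_arcsD2 by (auto simp: A_iff)
  have wP: "w (a, (u, v)) n \<in> ?P" if "(a, (u, v)) \<in> A" for a u v n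
    using w(1)[OF that] NP by blast
  have noH1: "(u, w (a, (u, v)) n) \<notin> H b m" "(w (a, (u, v)) n, u) \<notin> H b m"
    if a: "(a, (u, v)) \<in> A" and b: "b \<in> A" for a u v n b m
  proof -
    let ?x = "w (a, (u, v)) n"
    have "(u, ?x) \<notin> bad" using w(2)[OF a] by (auto simp: bad_def out_nbrs_def)
    moreover have "(?x, u) \<notin> bad"
      using late[of a ?x] AF[OF a] wP[OF a] w(3)[OF a] by (auto simp: bad_def)
    ultimately show "(u, ?x) \<notin> H b m" "(?x, u) \<notin> H b m" using edge[OF b] by blast+
  qed
  have noH2: "(v, w (a, (u, v)) n) \<notin> H b m" "(w (a, (u, v)) n, v) \<notin> H b m"
    if a: "(a, (u, v)) \<in> A" and b: "b = (a, (u, v)) \<or> b \<in> underS z (a, (u, v))" for a u v n b m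
  proof -
    let ?x = "w (a, (u, v)) n"
    have b': "b \<in> A" "(fst b, a) \<in> \<kappa>" using pred[of b "(a, (u, v))"] a b by auto
    have "(\<rho> v, a) \<notin> \<kappa>" using late[of a v] AF[OF a] a by (auto simp: A_iff)
    then have "b \<noteq> (\<rho> v, (v, ?x))" using b' by auto
    moreover have "(?x, v) \<notin> bad" using w(1)[OF a] anti by (auto simp: bad_def out_nbrs_def)
    ultimately show "(v, ?x) \<notin> H b m" "(?x, v) \<notin> H b m" using edge[OF b'(1)] by blast+
  qed
  have noH3: "(u, v) \<notin> H b m" if a: "(a, (u, v)) \<in> A" and b: "b \<in> underS z (a, (u, v))" for a u v b m
  proof
    assume "(u, v) \<in> H b m"
    moreover have b': "b \<in> A" "b \<noteq> (a, (u, v))" using pred[of b "(a, (u, v))"] b by (auto simp: underS_def)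
    ultimately have "(v, u) \<in> bad" using edge[of b u v m] a by (auto simp: A_iff)
    then show False using a anti by (auto simp: bad_def A_iff)
  qed
  have symH: "(x, y) \<in> H b m \<longleftrightarrow> (y, x) \<in> H b m" and symG: "(x, y) \<in> G b m \<longleftrightarrow> (y, x) \<in> G b m" for x y b m
    by (cases b; auto simp: H_def G_def Let_def)+
  have "\<exists>c :: ('v, 'v) cycle_seq.
      reversal D c (flipped D (\<lambda>u v. card {(a, n). a \<in> Field z \<and> (u, v) \<in> H a n}))"
  proof (rule reversal_blocks[OF T _ Wz, where s = s and G = G])
    show "infinite (UNIV :: 'v set)" using infP finite_subset[OF subset_UNIV] by blast
    have "|A| \<le>o |bad|" unfolding A_def by (rule card_of_image)
    also have "|bad| \<le>o |?P \<times> ?P|"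
      using in_arcsD1 in_arcsD2 by (intro card_of_mono1) (auto simp: bad_def)
    also have "|?P \<times> ?P| =o |?P|" by (rule card_of_Times_same_infinite[OF infP])
    also have "|?P| \<le>o |UNIV :: 'v set|" by (intro card_of_mono1) simp
    finally show "|Field z| \<le>o |UNIV :: 'v set|" by (simp add: Fz)
  next
    fix a n x y assume "a \<in> Field z"
    obtain a' u v where "a = (a', (u, v))" by (metis surj_pair)
    then show "(x, y) \<in> s a n \<or> (y, x) \<in> s a n \<longleftrightarrow>
      (x, y) \<in> H a n \<or> (x, y) \<in> G a n \<or> (\<exists>m. n = Suc m \<and> (x, y) \<in> G a m)"
      by (cases n) (auto simp: s_def H_def G_def Let_def)
  next
    fix a n assume a: "a \<in> Field z"
    obtain a' u v where a': "a = (a', (u, v))" by (metis surj_pair)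
    then have A: "(a', (u, v)) \<in> A" using a Fz by simp
    show "H a n \<inter> G a n = {}" "H a (Suc n) \<inter> G a n = {}"
      using nes[OF A] by (auto simp: H_def G_def Let_def a')
    have "w a n \<noteq> w a (Suc n)" using w_inj[of a a n "Suc n"] a Fz by auto
    then show "G a n \<inter> G a (Suc n) = {}"
      using nes[OF A] by (auto simp: G_def Let_def a')
  next
    fix e :: "'v \<times> 'v"
    obtain x y where e: "e = (x, y)" by (cases e)
    have "{(a, n). a \<in> Field z \<and> e \<in> H a n} \<subseteq> {(\<rho> x, (x, y)), (\<rho> y, (y, x))} \<times> {0}"
    proof (rule subrelI)
      fix a n assume "(a, n) \<in> {(a, n). a \<in> Field z \<and> e \<in> H a n}"
      then show "(a, n) \<in> {(\<rho> x, (x, y)), (\<rho> y, (y, x))} \<times> {0}"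
        using edge[of a x y n] H_iff[of x y a n] unfolding Fz e by blast
    qed
    then show "finite {(a, n). a \<in> Field z \<and> e \<in> H a n}" by (rule finite_subset) simp
    let ?B = "\<lambda>x. {(a, n). a \<in> A \<and> w a n = x}"
    have B: "finite (?B x)" for x
    proof (cases "?B x = {}")
      case False
      then obtain i where "i \<in> ?B x" by blast
      then have "?B x \<subseteq> {i}" using w_inj by auto
      then show ?thesis by (rule finite_subset) simp
    qed (simp only: finite.emptyI)
    have "{(a, n). a \<in> Field z \<and> e \<in> G a n} \<subseteq> ?B x \<union> ?B y"
      by (auto simp: G_def Let_def Fz e)
    then show "finite {(a, n). a \<in> Field z \<and> e \<in> G a n}"
      by (rule finite_subset) (simp only: finite_Un B simp_thms)
  next
    fix a n assume a: "a \<in> Field z"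
    obtain a' u v where a': "a = (a', (u, v))" by (metis surj_pair)
    then have A: "(a', (u, v)) \<in> A" using a Fz by simp
    let ?k = "\<lambda>x y. card {(b, m). b \<in> underS z a \<and> (x, y) \<in> H b m} +
      card {m. m < n \<and> (x, y) \<in> H a m} + (if \<exists>m. n = Suc m \<and> (x, y) \<in> G a m then 1 else 0)"
    let ?E = "flipped D ?k"
    have TE: "tournament ?E" by (rule tournament_flipped[OF T]) (simp add: symH symG)
    have uS: "b \<in> A" if "b \<in> underS z a" for b using that pred by blast
    have k1: "?k x y = (if \<exists>m. n = Suc m \<and> (x, y) \<in> G a m then 1 else 0)"
      if "\<And>b m. b \<in> underS z a \<Longrightarrow> (x, y) \<notin> H b m" "\<And>m. m < n \<Longrightarrow> (x, y) \<notin> H a m" for x y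
    proof -
      have "{(b, m). b \<in> underS z a \<and> (x, y) \<in> H b m} = {}" "{m. m < n \<and> (x, y) \<in> H a m} = {}"
        using that by auto
      then show ?thesis by (simp only: card.empty add_0)
    qed
    have k1': "?k x y = (if \<exists>m. n = Suc m \<and> (x, y) \<in> G a m then 1 else 0)"
      if "\<And>b m. b = a \<or> b \<in> underS z a \<Longrightarrow> (x, y) \<notin> H b m" for x y
      by (rule k1) (use that in blast)+
    have Duv: "(u, v) \<in> parcs D" using A by (simp add: A_iff)
    have D: "(v, w a m) \<in> parcs D" "(w a m, u) \<in> parcs D" for m
    proof -
      show "(v, w a m) \<in> parcs D" using w(1)[OF A] by (simp add: a' out_nbrs_def)
      show "(w a m, u) \<in> parcs D"
        using exactly_one_arc[of u "w a m"] w(2)[OF A, of m] AF[OF A] wP[OF A, of m] nes[OF A, of m]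
        by (auto simp: a' out_nbrs_def)
    qed
    have k2: "?k u (w a m) = (if n = Suc m then 1 else 0)" "?k (w a m) u = (if n = Suc m then 1 else 0)"
      "?k v (w a m) = (if n = Suc m then 1 else 0)" "?k (w a m) v = (if n = Suc m then 1 else 0)" for m
    proof -
      have g: "(u, w a m) \<in> G a l \<longleftrightarrow> m = l" "(w a m, u) \<in> G a l \<longleftrightarrow> m = l"
        "(v, w a m) \<in> G a l \<longleftrightarrow> m = l" "(w a m, v) \<in> G a l \<longleftrightarrow> m = l" for l
        using w_inj[of a a m l] nes[OF A] a Fz by (auto simp: G_def a' Let_def)
      have h: "(u, w a m) \<notin> H b l" "(w a m, u) \<notin> H b l" "(v, w a m) \<notin> H b l" "(w a m, v) \<notin> H b l"
        if "b = a \<or> b \<in> underS z a" for b l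
        using noH1[OF A, of b m l] noH2[OF A, of b m l] that uS A unfolding a' by blast+
      have n: "(\<exists>l. n = Suc l \<and> m = l) \<longleftrightarrow> n = Suc m" by blast
      show "?k u (w a m) = (if n = Suc m then 1 else 0)" by (rule trans[OF k1'[OF h(1)]]) (simp_all only: g n)
      show "?k (w a m) u = (if n = Suc m then 1 else 0)" by (rule trans[OF k1'[OF h(2)]]) (simp_all only: g n)
      show "?k v (w a m) = (if n = Suc m then 1 else 0)" by (rule trans[OF k1'[OF h(3)]]) (simp_all only: g n)
      show "?k (w a m) v = (if n = Suc m then 1 else 0)" by (rule trans[OF k1'[OF h(4)]]) (simp_all only: g n)
    qed
    have Vuv: "u \<in> ?P" "v \<in> ?P" "u \<noteq> v" using AF[OF A] nes[OF A] by auto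
    have V: "w a m \<in> ?P" "w a m \<noteq> u" "w a m \<noteq> v" for m
      using wP[OF A] nes[OF A] by (auto simp: a')
    show "directed_cycle ?E (s a n)"
    proof (cases n)
      case 0
      have "?k u v = 0"
        by (rule trans[OF k1]) (use noH3[OF A] 0 a' in simp_all)
      then have "(u, v) \<in> parcs ?E" using Duv Vuv by (simp only: in_flipped_iff) simp
      moreover have "(v, w a 0) \<in> parcs ?E" "(w a 0, u) \<in> parcs ?E"
        using D[of 0] V[of 0] Vuv k2[of 0] 0 by (simp_all only: in_flipped_iff) auto
      ultimately have "directed_cycle ?E {(u, v), (v, w a 0), (w a 0, u)}"
        by (intro directed_cycleI3[OF TE])
      moreover have "s a n = {(u, v), (v, w a 0), (w a 0, u)}" by (simp add: s_def a' 0 Let_def)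
      ultimately show ?thesis by simp
    next
      case (Suc m)
      have "(u, w a m) \<in> parcs ?E" "(w a m, v) \<in> parcs ?E" "(v, w a n) \<in> parcs ?E" "(w a n, u) \<in> parcs ?E"
        using D[of m] D[of n] V[of m] V[of n] Vuv k2[of m] k2[of n] Suc
          anti[OF D(1)[of m]] anti[OF D(2)[of m]]
        by (simp_all only: in_flipped_iff) auto
      moreover have "w a m \<noteq> w a n" using w_inj[of a a m n] a Fz Suc by auto
      ultimately have "directed_cycle ?E {(u, w a m), (w a m, v), (v, w a n), (w a n, u)}"
        using Vuv by (intro directed_cycleI4[OF TE])
      moreover have "s a n = {(u, w a m), (w a m, v), (v, w a n), (w a n, u)}"
        by (simp add: s_def a' Suc Let_def)
      ultimately show ?thesis by simp
    qed
  qed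
  then obtain c :: "('v, 'v) cycle_seq" where
    c: "reversal D c (flipped D (\<lambda>u v. card {(a, n). a \<in> A \<and> (u, v) \<in> H a n}))"
    unfolding Fz by blast
  have closed: "v \<in> W a" if a: "a \<in> Field \<kappa>" "u \<in> W a"
    and uv: "(u, v) \<in> parcs (flipped D (\<lambda>u v. card {(a, n). a \<in> A \<and> (u, v) \<in> H a n}))" for a u v
  proof (rule ccontr)
    assume v: "v \<notin> W a"
    let ?S = "{(a, n). a \<in> A \<and> (u, v) \<in> H a n}"
    have uvP: "u \<in> ?P" "v \<in> ?P" "u \<noteq> v" and par: "(u, v) \<in> parcs D \<longleftrightarrow> even (card ?S)"
      using uv by (auto simp: in_flipped_iff)
    have "u \<in> W (\<rho> v)" using late[OF a(1) v uvP(2)] a by blast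
    then have nb: "(v, u) \<notin> bad" by (simp add: bad_def)
    show False
    proof (cases "(u, v) \<in> parcs D")
      case True
      have "v \<notin> W (\<rho> u)" using \<rho>(3)[OF uvP(1) a] Wm v by blast
      then have A: "(\<rho> u, (u, v)) \<in> A" using True by (simp add: A_iff)
      have 1: "b = (\<rho> u, (u, v)) \<and> n = 0" if "b \<in> A" "(u, v) \<in> H b n" for b n
        using edge[OF that] nb that(2) by (auto simp: H_iff)
      have "(u, v) \<in> H (\<rho> u, (u, v)) 0" by (simp add: H_iff)
      then have S: "?S = {((\<rho> u, (u, v)), 0)}" using A 1 by blast
      show False using True par unfolding S by simp
    next
      case False
      then have "(u, v) \<notin> H b n" if "b \<in> A" for b n
        using edge[OF that, of u v n] nb by (auto simp: bad_def)
      then have S: "?S = {}" by auto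
      show False using False par unfolding S by simp
    qed
  qed
  have small: "|W a| <o \<kappa>" if "a \<in> Field \<kappa>" for a
    using WL L(2)[OF that] ordLeq_ordLess_trans by blast
  show ?thesis using c Wm small WU closed by blast
qed

section \<open>Countable tournaments\<close>

lemma exists_geodesic_ray:
  fixes E :: "('v \<times> 'v) set"
  assumes fin: "\<And>v. finite (E `` {v})" and inf: "infinite (E\<^sup>* `` {x})"
  obtains f :: "nat \<Rightarrow> 'v" where "f 0 = x" "\<And>n. (f n, f (Suc n)) \<in> E"
    "\<And>n m. (x, f n) \<in> E ^^ m \<Longrightarrow> n \<le> m"
proof -
  define d where "d y = (LEAST n. (x, y) \<in> E ^^ n)" for y
  \<comment> \<open>\<open>T y\<close> is the set of vertices with a shortest path from \<open>x\<close> through \<open>y\<close>; the ray is built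
    from vertices with infinite \<open>T y\<close>.\<close>
  define T where "T y = {z. \<exists>k. (y, z) \<in> E ^^ k \<and> d z = d y + k}" for y
  have d_rel: "(x, y) \<in> E ^^ d y" if "(x, y) \<in> E\<^sup>*" for y
    unfolding d_def using that by (metis LeastI_ex rtrancl_imp_relpow)
  have d_le: "d y \<le> n" if "(x, y) \<in> E ^^ n" for y n
    unfolding d_def using that by (rule Least_le)
  have d0: "d x = 0" using d_le[of x 0] by simp
  define Q where "Q n y \<longleftrightarrow> (x, y) \<in> E\<^sup>* \<and> d y = n \<and> infinite (T y)" for n y
  have "E\<^sup>* `` {x} \<subseteq> T x" using d_rel d0 by (auto simp: T_def)
  then have Q0: "Q 0 x" using inf d0 by (auto simp: Q_def dest: finite_subset)
  have QS: "\<exists>y'. Q (Suc n) y' \<and> (y, y') \<in> E" if q: "Q n y" for n y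
  proof (rule ccontr)
    assume no: "\<nexists>y'. Q (Suc n) y' \<and> (y, y') \<in> E"
    have "T y \<subseteq> insert y (\<Union>y' \<in> {y' \<in> E `` {y}. d y' = Suc n}. T y')"
    proof
      fix w assume "w \<in> T y"
      then obtain k where k: "(y, w) \<in> E ^^ k" "d w = n + k" using q by (auto simp: T_def Q_def)
      show "w \<in> insert y (\<Union>y' \<in> {y' \<in> E `` {y}. d y' = Suc n}. T y')"
      proof (cases k)
        case 0
        then show ?thesis using k by simp
      next
        case (Suc j)
        obtain y' where y': "(y, y') \<in> E" "(y', w) \<in> E ^^ j"
          using k(1) unfolding Suc by (meson relpow_Suc_D2)
        have xy: "(x, y) \<in> E ^^ n" using d_rel[of y] q by (auto simp: Q_def)
        then have xy': "(x, y') \<in> E ^^ Suc n" using y'(1) by auto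
        have "(x, y') \<in> E ^^ d y'" using d_rel xy' relpow_imp_rtrancl by blast
        then have "(x, w) \<in> E ^^ (d y' + j)" using y'(2) by (auto simp: relpow_add)
        then have "d w \<le> d y' + j" by (rule d_le)
        then have "d y' = Suc n" using d_le[OF xy'] k(2) Suc by simp
        then show ?thesis using y' k(2) Suc by (auto simp: T_def)
      qed
    qed
    moreover have "finite (T y')" if "y' \<in> {y' \<in> E `` {y}. d y' = Suc n}" for y'
    proof -
      have "(x, y') \<in> E\<^sup>*" using q that by (auto simp: Q_def)
      then show ?thesis using no that by (auto simp: Q_def)
    qed
    moreover have "finite {y' \<in> E `` {y}. d y' = Suc n}"
      by (rule finite_subset[OF _ fin[of y]]) blast
    ultimately have "finite (T y)" by (metis (no_types, lifting) finite_UN finite_insert finite_subset)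
    then show False using q by (simp add: Q_def)
  qed
  obtain f where f: "\<And>n. Q n (f n)" "\<And>n. (f n, f (Suc n)) \<in> E"
    using dependent_nat_choice[of Q "\<lambda>n y y'. (y, y') \<in> E"] Q0 QS by metis
  show thesis
  proof (rule that)
    show "f 0 = x" using f(1)[of 0] d_rel[of "f 0"] by (simp add: Q_def)
    show "(f n, f (Suc n)) \<in> E" for n by fact
    show "n \<le> m" if "(x, f n) \<in> E ^^ m" for n m
      using d_le[OF that] f(1)[of n] by (simp add: Q_def)
  qed
qed

definition fin_reach :: "('v \<times> 'v) set \<Rightarrow> 'v set" where
  "fin_reach E = {x. finite (E\<^sup>* `` {x})}"

lemma fin_reach_step: "x \<in> fin_reach E \<Longrightarrow> (x, y) \<in> E \<Longrightarrow> y \<in> fin_reach E"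
  by (auto simp: fin_reach_def intro: converse_rtrancl_into_rtrancl elim!: finite_subset[rotated])

lemma reach_subset:
  assumes "\<And>x y. x \<in> fin_reach E \<Longrightarrow> (x, y) \<in> E' \<Longrightarrow> (x, y) \<in> E" and "x \<in> fin_reach E"
  shows "E'\<^sup>* `` {x} \<subseteq> E\<^sup>* `` {x}"
proof clarify
  fix y assume "(x, y) \<in> E'\<^sup>*"
  then have "y \<in> fin_reach E \<and> (x, y) \<in> E\<^sup>*"
  proof induction
    case base
    then show ?case using assms(2) by simp
  next
    case (step y w)
    then have "(y, w) \<in> E" using assms(1) by blast
    then show ?case using step.IH fin_reach_step[of y E w] by (auto intro: rtrancl_into_rtrancl)
  qed
  then show "(x, y) \<in> E\<^sup>*" ..
qed

definition loc_fin_tournament :: "'v set \<Rightarrow> ('v \<times> 'v) set \<Rightarrow> bool" where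
  "loc_fin_tournament P E \<longleftrightarrow> E \<subseteq> P \<times> P \<and> (\<forall>u. (u, u) \<notin> E) \<and>
    (\<forall>u \<in> P. \<forall>v \<in> P. u \<noteq> v \<longrightarrow> ((u, v) \<in> E) \<noteq> ((v, u) \<in> E)) \<and> (\<forall>v. finite (E `` {v}))"

lemma loc_fin_tournamentD:
  assumes "loc_fin_tournament P E"
  shows "E \<subseteq> P \<times> P" "(u, u) \<notin> E"
    "u \<in> P \<Longrightarrow> v \<in> P \<Longrightarrow> u \<noteq> v \<Longrightarrow> ((u, v) \<in> E) \<noteq> ((v, u) \<in> E)" "finite (E `` {v})"
  using assms unfolding loc_fin_tournament_def by blast+

text \<open>Rays whose later vertices dominate \<open>f 0\<close> can be reversed using triangles only.\<close>

definition dominated_ray :: "('v \<times> 'v) set \<Rightarrow> (nat \<Rightarrow> 'v) \<Rightarrow> bool" where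
  "dominated_ray E f \<longleftrightarrow> inj f \<and> (\<forall>n. (f n, f (Suc n)) \<in> E) \<and> (\<forall>n. (f (Suc (Suc n)), f 0) \<in> E)"

definition ray_arcs :: "(nat \<Rightarrow> 'v) \<Rightarrow> ('v \<times> 'v) set" where
  "ray_arcs f = {(f n, f (Suc n)) | n. True}"

definition flip_ray :: "('v \<times> 'v) set \<Rightarrow> (nat \<Rightarrow> 'v) \<Rightarrow> ('v \<times> 'v) set" where
  "flip_ray E f = (E - ray_arcs f) \<union> (ray_arcs f)\<inverse>"

lemma exists_dominated_ray:
  assumes E: "loc_fin_tournament P E" and x: "x \<notin> fin_reach E"
  shows "\<exists>f. dominated_ray E f \<and> f 0 = x"
proof -
  obtain f where f: "f 0 = x" "\<And>n. (f n, f (Suc n)) \<in> E" "\<And>n m. (x, f n) \<in> E ^^ m \<Longrightarrow> n \<le> m"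
    using exists_geodesic_ray[of E x] E x by (auto simp: loc_fin_tournament_def fin_reach_def)
  have rel: "(x, f n) \<in> E ^^ n" for n
    by (induction n) (use f in auto)
  have inj: "inj f"
    using f(3) rel by (metis injI antisym)
  have "(f (Suc (Suc n)), f 0) \<in> E" for n
  proof -
    have "(x, f (Suc (Suc n))) \<notin> E" using f(3)[of "Suc (Suc n)" 1] by auto
    moreover have "f (Suc (Suc n)) \<noteq> f 0" using inj by (simp add: inj_eq)
    moreover have "f k \<in> P" for k using f(2)[of k] E by (auto simp: loc_fin_tournament_def)
    ultimately show ?thesis using E f(1) unfolding loc_fin_tournament_def by metis
  qed
  then show ?thesis using f inj unfolding dominated_ray_def by blast
qed

lemma ray_arcs_subset: "dominated_ray E f \<Longrightarrow> ray_arcs f \<subseteq> E"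
  by (auto simp: dominated_ray_def ray_arcs_def)

lemma loc_fin_tournament_flip_ray:
  assumes E: "loc_fin_tournament P E" and f: "dominated_ray E f"
  shows "loc_fin_tournament P (flip_ray E f)"
proof -
  have sub: "ray_arcs f \<subseteq> E" using f by (rule ray_arcs_subset)
  have asym: "(v, u) \<notin> E" if "(u, v) \<in> E" for u v
  proof -
    have "u \<in> P" "v \<in> P" "u \<noteq> v" using E that by (auto simp: loc_fin_tournament_def)
    then show ?thesis using loc_fin_tournamentD(3)[OF E] that by blast
  qed
  have "finite (flip_ray E f `` {v})" for v
  proof -
    have "flip_ray E f `` {v} \<subseteq> E `` {v} \<union> f ` {n. f (Suc n) = v}"
      by (auto simp: flip_ray_def ray_arcs_def)
    moreover have "finite {n. f (Suc n) = v}"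
    proof -
      have "finite (Suc -` (f -` {v}))"
        using f by (intro finite_vimageI) (simp_all add: dominated_ray_def)
      then show ?thesis by (simp add: vimage_def)
    qed
    moreover have "finite (E `` {v})" using E by (simp add: loc_fin_tournament_def)
    ultimately show ?thesis by (meson finite_Un finite_imageI finite_subset)
  qed
  moreover have "flip_ray E f \<subseteq> P \<times> P" "(u, u) \<notin> flip_ray E f" for u
    using sub E by (auto simp: flip_ray_def loc_fin_tournament_def)
  moreover have "((u, v) \<in> flip_ray E f) \<noteq> ((v, u) \<in> flip_ray E f)"
    if "u \<in> P" "v \<in> P" "u \<noteq> v" for u v
  proof -
    show ?thesis
      using loc_fin_tournamentD(3)[OF E that] sub asym[of u v] asym[of v u]
      unfolding flip_ray_def by blast
  qed
  ultimately show ?thesis unfolding loc_fin_tournament_def by blast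
qed

lemma dominated_ray_not_fin_reach:
  assumes "dominated_ray E f"
  shows "f n \<notin> fin_reach E"
proof -
  have "(f n, f (n + k)) \<in> E\<^sup>*" for k
    by (induction k) (use assms in \<open>auto simp: dominated_ray_def intro: rtrancl_into_rtrancl\<close>)
  then have "range (\<lambda>k. f (n + k)) \<subseteq> E\<^sup>* `` {f n}" by blast
  moreover have "infinite (range (\<lambda>k. f (n + k)))"
  proof (intro range_inj_infinite injI)
    fix j k assume "f (n + j) = f (n + k)"
    then show "j = k" using assms by (simp add: dominated_ray_def inj_eq)
  qed
  ultimately show ?thesis by (auto simp: fin_reach_def dest: finite_subset)
qed

lemma flip_ray_fin_reach:
  assumes "dominated_ray E f" "x \<in> fin_reach E" "(x, y) \<in> flip_ray E f"
  shows "(x, y) \<in> E"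
  using assms dominated_ray_not_fin_reach[OF assms(1)] by (auto simp: flip_ray_def ray_arcs_def)

lemma fin_reach_flip_ray:
  assumes "dominated_ray E f"
  shows "fin_reach E \<subseteq> fin_reach (flip_ray E f)"
proof
  fix x assume "x \<in> fin_reach E"
  then show "x \<in> fin_reach (flip_ray E f)"
    using reach_subset[of E "flip_ray E f" x] flip_ray_fin_reach[OF assms]
    by (auto simp: fin_reach_def elim: finite_subset)
qed

lemma card_flip_ray_less:
  assumes E: "loc_fin_tournament P E" and f: "dominated_ray E f"
  shows "card (flip_ray E f `` {f 0}) < card (E `` {f 0})"
proof (rule psubset_card_mono)
  show "finite (E `` {f 0})" using E by (simp add: loc_fin_tournament_def)
  have "f (Suc n) \<noteq> f 0" for n using f by (simp add: dominated_ray_def inj_eq)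
  then have "flip_ray E f `` {f 0} \<subseteq> E `` {f 0}"
    by (auto simp: flip_ray_def ray_arcs_def) metis
  moreover have "f 1 \<in> E `` {f 0}" using f by (simp add: dominated_ray_def)
  moreover have "f 1 \<notin> flip_ray E f `` {f 0}"
  proof -
    have "(f 0, f 1) \<in> ray_arcs f" by (auto simp: ray_arcs_def intro: exI[of _ 0])
    moreover have "(f 1, f 0) \<notin> ray_arcs f" using f by (auto simp: ray_arcs_def dominated_ray_def inj_eq)
    ultimately show ?thesis by (auto simp: flip_ray_def)
  qed
  ultimately show "flip_ray E f `` {f 0} \<subset> E `` {f 0}" by blast
qed

definition ray_edge :: "(nat \<Rightarrow> 'v) \<Rightarrow> nat \<Rightarrow> ('v \<times> 'v) set" where
  "ray_edge f l = {(f l, f (Suc l)), (f (Suc l), f l)}"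

lemma ray_edge_unique:
  assumes "inj f" "e \<in> ray_edge f l" "e \<in> ray_edge f m"
  shows "l = m"
  using assms by (auto simp: ray_edge_def inj_eq)

lemma in_ray_edges_iff: "(\<exists>l. (x, y) \<in> ray_edge f l) \<longleftrightarrow> (x, y) \<in> ray_arcs f \<union> (ray_arcs f)\<inverse>"
  by (auto simp: ray_edge_def ray_arcs_def)

lemma in_flip_ray_iff:
  assumes E: "loc_fin_tournament P E" and f: "dominated_ray E f" and xy: "x \<in> P" "y \<in> P" "x \<noteq> y"
  shows "(x, y) \<in> flip_ray E f \<longleftrightarrow> ((x, y) \<in> E \<longleftrightarrow> \<not> (\<exists>l. (x, y) \<in> ray_edge f l))"
  using ray_arcs_subset[OF f] loc_fin_tournamentD(3)[OF E xy]
  unfolding in_ray_edges_iff flip_ray_def by blast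

lemma exists_finite_reach:
  fixes D :: "'v pair_pre_digraph"
  assumes T: "tournament D" and e: "bij_betw e (UNIV :: nat set) (pverts D)"
    and deg: "\<And>v. finite (parcs D `` {v})"
  shows "\<exists>(c :: ('v, 'v) cycle_seq) D'. reversal D c D' \<and>
    (\<forall>x \<in> pverts D. finite ((parcs D')\<^sup>* `` {x}))"
proof -
  interpret tournament D by (rule T)
  let ?P = "pverts D"
  have infP: "infinite ?P" using e bij_betw_finite infinite_UNIV_nat by blast
  define active where "active E \<longleftrightarrow> (\<exists>i. e i \<notin> fin_reach E)" for E
  define first where "first E = e (LEAST i. e i \<notin> fin_reach E)" for E
  define ray where "ray E = (SOME f. dominated_ray E f \<and> f 0 = first E)" for E
  define next_arcs where "next_arcs E = (if active E then flip_ray E (ray E) else E)" for E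
  define Es where "Es n = (next_arcs ^^ n) (parcs D)" for n
  define fs where "fs n = ray (Es n)" for n
  define A where "A = {n. active (Es n)}"
  have ray: "dominated_ray E (ray E) \<and> ray E 0 = first E" if "loc_fin_tournament ?P E" "active E" for E
  proof -
    have "first E \<notin> fin_reach E"
      using that(2) unfolding active_def first_def by (rule LeastI_ex)
    then show ?thesis unfolding ray_def by (rule someI_ex[OF exists_dominated_ray[OF that(1)]])
  qed
  have Es0: "Es 0 = parcs D" by (simp add: Es_def)
  have EsS: "Es (Suc n) = (if n \<in> A then flip_ray (Es n) (fs n) else Es n)" for n
    by (simp add: Es_def next_arcs_def A_def fs_def)
  have lf: "loc_fin_tournament ?P (Es n)" for n
  proof (induction n)
    case 0
    show ?case unfolding Es0 loc_fin_tournament_def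
    proof (intro conjI allI ballI impI)
      show "parcs D \<subseteq> ?P \<times> ?P" using in_arcsD1 in_arcsD2 by auto
      show "(u, u) \<notin> parcs D" for u using pair_no_loops[of "(u, u)"] by auto
    qed (use exactly_one_arc deg in blast)+
  next
    case (Suc n)
    then show ?case using ray loc_fin_tournament_flip_ray by (auto simp: EsS A_def fs_def)
  qed
  have fs: "dominated_ray (Es n) (fs n)" "fs n 0 = first (Es n)" if "n \<in> A" for n
    using ray[OF lf] that by (auto simp: A_def fs_def)
  have inj: "inj (fs n)" and fs_arc: "(fs n k, fs n (Suc k)) \<in> Es n" "(fs n (Suc (Suc k)), fs n 0) \<in> Es n"
    if "n \<in> A" for n k
    using fs(1)[OF that] by (auto simp: dominated_ray_def)
  have fsP: "fs n k \<in> ?P" if "n \<in> A" for n k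
    using fs_arc(1)[OF that] loc_fin_tournamentD(1)[OF lf] by blast
  have F_Suc: "fin_reach (Es n) \<subseteq> fin_reach (Es (Suc n))" for n
    using fin_reach_flip_ray[OF fs(1), of n] by (simp add: EsS)
  have F_mono: "fin_reach (Es m) \<subseteq> fin_reach (Es n)" if "m \<le> n" for m n
    using lift_Suc_mono_le[of "\<lambda>n. fin_reach (Es n)", OF F_Suc that] .
  have fs_nF: "fs n k \<notin> fin_reach (Es m)" if "n \<in> A" "m \<le> n" for n k m
    using dominated_ray_not_fin_reach[OF fs(1)[OF that(1)]] F_mono[OF that(2)] by blast
  have eventually: "\<exists>m. e i \<in> fin_reach (Es m)" for i
  proof (induction i rule: less_induct)
    case (less i)
    then obtain g where g: "\<And>j. j < i \<Longrightarrow> e j \<in> fin_reach (Es (g j))" by metis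
    define M where "M = (\<Sum>j<i. g j)"
    have M: "e j \<in> fin_reach (Es m)" if "j < i" "M \<le> m" for j m
    proof -
      have "g j \<le> M" unfolding M_def using that by (intro member_le_sum) auto
      then show ?thesis using g[OF that(1)] F_mono[of "g j" m] that(2) by auto
    qed
    show ?case
    proof (rule ccontr)
      assume no: "\<nexists>m. e i \<in> fin_reach (Es m)"
      have dec: "card (Es (Suc m) `` {e i}) < card (Es m `` {e i})" if m: "M \<le> m" for m
      proof -
        have mA: "m \<in> A" using no by (auto simp: A_def active_def)
        have "(LEAST j. e j \<notin> fin_reach (Es m)) = i"
          using no M[OF _ m] by (intro Least_equality) (auto simp: not_less[symmetric])
        then have "fs m 0 = e i" using fs(2)[OF mA] by (simp add: first_def)
        then show ?thesis using card_flip_ray_less[OF lf fs(1)[OF mA]] mA by (simp add: EsS)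
      qed
      have "card (Es (M + k) `` {e i}) + k \<le> card (Es M `` {e i})" for k
      proof (induction k)
        case (Suc k)
        then show ?case using dec[of "M + k"] by simp
      qed simp
      from this[of "Suc (card (Es M `` {e i}))"] show False by simp
    qed
  qed
  have late: "\<exists>M. x \<in> fin_reach (Es M)" if "x \<in> ?P" for x
  proof -
    obtain i where "x = e i" using e \<open>x \<in> ?P\<close> by (auto simp: bij_betw_def)
    then show ?thesis using eventually by blast
  qed
  define z where "z = Restr natLeq A"
  have Wz: "Well_order z" unfolding z_def using natLeq_Well_order by (rule Well_order_Restr)
  have Fz: "Field z = A" unfolding z_def by (auto simp: Field_def natLeq_def)
  have uS: "underS z a = {m \<in> A. m < a}" if "a \<in> A" for a
    using that by (auto simp: z_def underS_def natLeq_def)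
  \<comment> \<open>The first triangle reverses two arcs of the ray for good, hence the truncated subtraction.\<close>
  define H where "H a n = (\<Union>l \<in> {l. l - 1 = n}. ray_edge (fs a) l)" for a n
  define G where "G a n = {(fs a 0, fs a (Suc (Suc n))), (fs a (Suc (Suc n)), fs a 0)}" for a n
  define s where "s a n = {(fs a 0, fs a (Suc n)), (fs a (Suc n), fs a (Suc (Suc n))),
      (fs a (Suc (Suc n)), fs a 0)}" for a n
  have H_iff: "(x, y) \<in> H a n \<longleftrightarrow> (\<exists>l. l - 1 = n \<and> (x, y) \<in> ray_edge (fs a) l)" for x y a n
    by (auto simp: H_def)
  have H_uniq: "m = n" if "a \<in> A" "x \<in> H a m" "x \<in> H a n" for x a m n
    using that(2,3) ray_edge_unique[OF inj[OF that(1)], of x] unfolding H_def by blast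
  have finH1: "finite {n. x \<in> H a n}" if a: "a \<in> A" for x a
  proof (cases "{n. x \<in> H a n} = {}")
    case False
    then obtain n where n: "x \<in> H a n" by auto
    have "{n. x \<in> H a n} \<subseteq> {n}" using H_uniq[OF a _ n] by blast
    then show ?thesis by (rule finite_subset) simp
  qed (simp only: finite.emptyI)
  have cardH1: "even (card {n. (x, y) \<in> H a n}) \<longleftrightarrow> \<not> (\<exists>l. (x, y) \<in> ray_edge (fs a) l)"
    if a: "a \<in> A" for x y a
  proof (cases "\<exists>l. (x, y) \<in> ray_edge (fs a) l")
    case True
    then obtain n where n: "(x, y) \<in> H a n" by (auto simp: H_iff)
    have "{n. (x, y) \<in> H a n} = {n}" using H_uniq[OF a _ n] n by blast
    then have "card {n. (x, y) \<in> H a n} = 1" unfolding One_nat_def card_1_singleton_iff by blast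
    then show ?thesis using True by (simp only: odd_one simp_thms)
  next
    case False
    then have "{n. (x, y) \<in> H a n} = {}" by (auto simp: H_iff)
    then show ?thesis using False by (simp only: card.empty even_zero simp_thms)
  qed
  have Es_iff: "(x, y) \<in> Es a \<longleftrightarrow> ((x, y) \<in> parcs D \<longleftrightarrow>
      even (card {(b, m). b \<in> {m \<in> A. m < a} \<and> (x, y) \<in> H b m}))"
    if xy: "x \<in> ?P" "y \<in> ?P" "x \<noteq> y" for x y a
  proof (induction a)
    case 0
    have "{(b, m). b \<in> {m \<in> A. m < 0} \<and> (x, y) \<in> H b m} = {}" by auto
    then show ?case by (simp only: card.empty even_zero simp_thms Es0)
  next
    case (Suc a)
    let ?S = "\<lambda>a. {(b, m). b \<in> {m \<in> A. m < a} \<and> (x, y) \<in> H b m}"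
    show ?case
    proof (cases "a \<in> A")
      case True
      have S: "?S (Suc a) = ?S a \<union> Pair a ` {n. (x, y) \<in> H a n}" using True by (auto simp: less_Suc_eq)
      have "?S a = Sigma {m \<in> A. m < a} (\<lambda>b. {n. (x, y) \<in> H b n})" by auto
      then have "finite (?S a)" using finH1 by (simp only:) (intro finite_SigmaI, auto)
      then have "card (?S (Suc a)) = card (?S a) + card {n. (x, y) \<in> H a n}"
        unfolding S using finH1[OF True]
        by (subst card_Un_disjoint) (auto simp: card_image inj_on_def)
      then show ?thesis
        using Suc cardH1[OF True] in_flip_ray_iff[OF lf fs(1)[OF True] xy] True
        by (simp only: EsS if_True even_add) blast
    next
      case False
      then have "?S (Suc a) = ?S a" by (auto simp: less_Suc_eq)
      then show ?thesis using Suc False by (simp only: EsS if_False)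
    qed
  qed
  have before: "a < M" if "a \<in> A" "x \<in> fin_reach (Es M)" "(x, y) \<in> H a n" for a M x y n
  proof (rule ccontr)
    assume "\<not> a < M"
    then show False using that fs_nF[OF that(1), of M] by (auto simp: H_iff ray_edge_def)
  qed
  have HP: "x \<in> ?P" if "a \<in> A" "(x, y) \<in> H a n" for a x y n
    using that fsP by (auto simp: H_iff ray_edge_def)
  have symH: "(x, y) \<in> H b m \<longleftrightarrow> (y, x) \<in> H b m" and symG: "(x, y) \<in> G b m \<longleftrightarrow> (y, x) \<in> G b m" for x y b m
    by (auto simp: H_def G_def ray_edge_def)
  have fs_eq: "fs a i = fs a j \<longleftrightarrow> i = j" if "a \<in> A" for a i j
    using inj[OF that] by (simp add: inj_eq)
  have "\<exists>c :: ('v, 'v) cycle_seq.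
      reversal D c (flipped D (\<lambda>u v. card {(a, n). a \<in> Field z \<and> (u, v) \<in> H a n}))"
  proof (rule reversal_blocks[OF T _ Wz, where s = s and G = G])
    show inf: "infinite (UNIV :: 'v set)" using infP finite_subset[OF subset_UNIV] by blast
    have "|A| \<le>o |UNIV :: nat set|" by (intro card_of_mono1) simp
    also have "|UNIV :: nat set| \<le>o |UNIV :: 'v set|" using inf by (simp flip: infinite_iff_card_of_nat)
    finally show "|Field z| \<le>o |UNIV :: 'v set|" by (simp add: Fz)
  next
    fix a n x y assume "a \<in> Field z"
    have "H a 0 = ray_edge (fs a) 0 \<union> ray_edge (fs a) 1"
    proof -
      have "{l :: nat. l - 1 = 0} = {0, 1}" by auto
      then show ?thesis unfolding H_def by (simp only:) auto
    qed
    moreover have "H a (Suc m) = ray_edge (fs a) (Suc (Suc m))" for m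
    proof -
      have "{l :: nat. l - 1 = Suc m} = {Suc (Suc m)}" by auto
      then show ?thesis unfolding H_def by (simp only:) auto
    qed
    ultimately show "(x, y) \<in> s a n \<or> (y, x) \<in> s a n \<longleftrightarrow>
      (x, y) \<in> H a n \<or> (x, y) \<in> G a n \<or> (\<exists>m. n = Suc m \<and> (x, y) \<in> G a m)"
      by (cases n) (auto simp: s_def G_def ray_edge_def)
  next
    fix a n assume "a \<in> Field z"
    then have a: "a \<in> A" by (simp add: Fz)
    show "H a n \<inter> G a n = {}" "H a (Suc n) \<inter> G a n = {}" "G a n \<inter> G a (Suc n) = {}"
      by (auto simp: H_def G_def ray_edge_def fs_eq[OF a])
  next
    fix u :: "'v \<times> 'v"
    obtain x y where u: "u = (x, y)" by (cases u)
    show "finite {(a, n). a \<in> Field z \<and> u \<in> H a n}"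
    proof (cases "x \<in> ?P")
      case True
      then obtain M where M: "x \<in> fin_reach (Es M)" using late by blast
      have "{(a, n). a \<in> Field z \<and> u \<in> H a n} \<subseteq> Sigma {a \<in> A. a < M} (\<lambda>a. {n. u \<in> H a n})"
        using before[OF _ M] by (auto simp: Fz u)
      moreover have "finite (Sigma {a \<in> A. a < M} (\<lambda>a. {n. u \<in> H a n}))"
        using finH1 by (intro finite_SigmaI) auto
      ultimately show ?thesis by (rule finite_subset)
    next
      case False
      then have "{(a, n). a \<in> Field z \<and> u \<in> H a n} = {}" using HP by (auto simp: Fz u)
      then show ?thesis by (simp only: finite.emptyI)
    qed
    show "finite {(a, n). a \<in> Field z \<and> u \<in> G a n}"
    proof (cases "x \<in> ?P")
      case True
      then obtain M where M: "x \<in> fin_reach (Es M)" using late by blast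
      let ?S = "\<lambda>a. {n. fs a (Suc (Suc n)) = x} \<union> {n. fs a (Suc (Suc n)) = y}"
      have "a < M" if "a \<in> A" "(x, y) \<in> G a n" for a n
        using that M fs_nF[OF that(1), of M] by (cases "a < M") (auto simp: G_def)
      then have "{(a, n). a \<in> Field z \<and> u \<in> G a n} \<subseteq> Sigma {a \<in> A. a < M} ?S"
        by (auto simp: Fz u G_def)
      moreover have "finite (?S a)" if "a \<in> A" for a
      proof -
        have "finite {n. fs a (Suc (Suc n)) = w}" for w
          using finite_vimageI[OF finite_vimageI[OF finite_vimageI[OF _ inj[OF that]] inj_Suc] inj_Suc, of "{w}"]
          by (simp add: vimage_def)
        then show ?thesis by blast
      qed
      then have "finite (Sigma {a \<in> A. a < M} ?S)" by (intro finite_SigmaI) auto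
      ultimately show ?thesis by (rule finite_subset)
    next
      case False
      then have "{(a, n). a \<in> Field z \<and> u \<in> G a n} = {}" using fsP by (auto simp: Fz u G_def)
      then show ?thesis by (simp only: finite.emptyI)
    qed
  next
    fix a n assume "a \<in> Field z"
    then have a: "a \<in> A" by (simp add: Fz)
    let ?f = "fs a"
    let ?k = "\<lambda>x y. card {(b, m). b \<in> underS z a \<and> (x, y) \<in> H b m} +
      card {m. m < n \<and> (x, y) \<in> H a m} + (if \<exists>m. n = Suc m \<and> (x, y) \<in> G a m then 1 else 0)"
    let ?E = "flipped D ?k"
    have TE: "tournament ?E" by (rule tournament_flipped[OF T]) (simp add: symH symG)
    have k: "(x, y) \<in> parcs ?E \<longleftrightarrow> ((x, y) \<in> Es a \<longleftrightarrow> \<not> (\<exists>m. n = Suc m \<and> (x, y) \<in> G a m))"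
      if xy: "x \<in> ?P" "y \<in> ?P" "x \<noteq> y" and no: "\<And>m. m < n \<Longrightarrow> (x, y) \<notin> H a m" for x y
    proof -
      have "{m. m < n \<and> (x, y) \<in> H a m} = {}" using no by auto
      then have "?k x y = card {(b, m). b \<in> {m \<in> A. m < a} \<and> (x, y) \<in> H b m} +
          (if \<exists>m. n = Suc m \<and> (x, y) \<in> G a m then 1 else 0)"
        by (simp only: uS[OF a] card.empty add_0_right)
      then show ?thesis
        using xy Es_iff[OF xy, of a] unfolding in_flipped_iff by (simp only: even_add) auto
    qed
    have "(?f 0, ?f (Suc n)) \<in> parcs ?E"
    proof (cases n)
      case 0
      then show ?thesis using k[of "?f 0" "?f (Suc n)"] fsP[OF a] fs_eq[OF a] fs_arc(1)[OF a, of 0] by auto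
    next
      case (Suc m)
      have "(?f 0, ?f (Suc n)) \<notin> Es a"
        using fs_arc(2)[OF a, of m] loc_fin_tournamentD(3)[OF lf, of "?f 0" "?f (Suc n)" a]
          fsP[OF a] fs_eq[OF a] Suc by auto
      moreover have "(?f 0, ?f (Suc n)) \<in> G a m" using Suc by (simp add: G_def)
      moreover have "(?f 0, ?f (Suc n)) \<notin> H a j" for j
        by (auto simp: H_iff ray_edge_def fs_eq[OF a] Suc)
      ultimately show ?thesis using k[of "?f 0" "?f (Suc n)"] fsP[OF a] fs_eq[OF a] Suc by auto
    qed
    moreover have "(?f (Suc n), ?f (Suc (Suc n))) \<in> parcs ?E"
    proof -
      have "(?f (Suc n), ?f (Suc (Suc n))) \<notin> H a m" if "m < n" for m
        using that by (auto simp: H_iff ray_edge_def fs_eq[OF a])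
      moreover have "(?f (Suc n), ?f (Suc (Suc n))) \<notin> G a m" for m
        by (auto simp: G_def fs_eq[OF a])
      ultimately show ?thesis
        using k[of "?f (Suc n)" "?f (Suc (Suc n))"] fsP[OF a] fs_eq[OF a] fs_arc(1)[OF a] by auto
    qed
    moreover have "(?f (Suc (Suc n)), ?f 0) \<in> parcs ?E"
    proof -
      have "(?f (Suc (Suc n)), ?f 0) \<notin> H a m" for m
        by (auto simp: H_iff ray_edge_def fs_eq[OF a])
      moreover have "(?f (Suc (Suc n)), ?f 0) \<notin> G a m" if "n = Suc m" for m
        using that by (auto simp: G_def fs_eq[OF a])
      ultimately show ?thesis
        using k[of "?f (Suc (Suc n))" "?f 0"] fsP[OF a] fs_eq[OF a] fs_arc(2)[OF a] by auto
    qed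
    ultimately show "directed_cycle ?E (s a n)"
      unfolding s_def by (intro directed_cycleI3[OF TE])
  qed
  then obtain c :: "('v, 'v) cycle_seq" where
    c: "reversal D c (flipped D (\<lambda>u v. card {(a, n). a \<in> A \<and> (u, v) \<in> H a n}))" (is "reversal D c ?D")
    unfolding Fz by blast
  have "finite ((parcs ?D)\<^sup>* `` {x})" if x: "x \<in> ?P" for x
  proof -
    obtain M where M: "x \<in> fin_reach (Es M)" using late x by blast
    have "(u, v) \<in> Es M" if u: "u \<in> fin_reach (Es M)" and uv: "(u, v) \<in> parcs ?D" for u v
    proof -
      have "{(a, n). a \<in> A \<and> (u, v) \<in> H a n} = {(b, m). b \<in> {m \<in> A. m < M} \<and> (u, v) \<in> H b m}"
        using before[OF _ u] by auto
      then show ?thesis using uv Es_iff[of u v M] by (simp only: in_flipped_iff) blast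
    qed
    then have "(parcs ?D)\<^sup>* `` {x} \<subseteq> (Es M)\<^sup>* `` {x}" using M by (rule reach_subset)
    then show ?thesis using M by (auto simp: fin_reach_def intro: finite_subset)
  qed
  then show ?thesis using c by blast
qed

section \<open>The partition\<close>

lemma exists_closed_chain:
  fixes \<kappa> :: "'k rel" and D :: "'v pair_pre_digraph"
  assumes T: "tournament D" and \<kappa>: "Cinfinite \<kappa>"
    and P: "|pverts D| =o \<kappa>" and deg: "\<forall>v \<in> pverts D. |out_nbrs D v| <o \<kappa>"
  shows "\<exists>(c :: ('v, 'v) cycle_seq) D' W. reversal D c D' \<and>
    (\<forall>a b. (a, b) \<in> \<kappa> \<longrightarrow> W a \<subseteq> W b) \<and> (\<forall>a \<in> Field \<kappa>. |W a| <o \<kappa>) \<and>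
    (\<Union>a \<in> Field \<kappa>. W a) = pverts D \<and>
    (\<forall>a \<in> Field \<kappa>. \<forall>u \<in> W a. \<forall>v. (u, v) \<in> parcs D' \<longrightarrow> v \<in> W a)"
proof (cases "natLeq <o \<kappa>")
  case True
  then show ?thesis using exists_closed_chain_uncountable[OF T \<kappa> _ P deg[rule_format]] by blast
next
  case False
  interpret tournament D by (rule T)
  have co: "Card_order \<kappa>" and wo: "Well_order \<kappa>"
    using \<kappa> by (auto simp: card_order_on_well_order_on)
  have refl: "(a, a) \<in> \<kappa>" if "a \<in> Field \<kappa>" for a
    using wo that by (auto simp: order_on_defs refl_on_def)
  have trans: "(a, b) \<in> \<kappa> \<Longrightarrow> (b, c) \<in> \<kappa> \<Longrightarrow> (a, c) \<in> \<kappa>" for a b c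
    using wo by (auto simp: order_on_defs dest: transD)
  have le: "\<kappa> \<le>o natLeq"
    using False ordLess_or_ordLeq[OF natLeq_Well_order wo] by blast
  have ge: "natLeq \<le>o \<kappa>" using \<kappa> by (rule natLeq_ordLeq_cinfinite)
  have fin: "finite X \<longleftrightarrow> |X| <o \<kappa>" for X :: "'x set"
    unfolding finite_iff_ordLess_natLeq
    using ordLess_ordLeq_trans[OF _ ge] ordLess_ordLeq_trans[OF _ le] by blast
  have "finite (parcs D `` {v})" for v
  proof (cases "v \<in> pverts D")
    case True
    then have "|out_nbrs D v| <o \<kappa>" using deg by blast
    then show ?thesis by (simp add: fin[symmetric] out_nbrs_def Image_singleton)
  next
    case False
    then have "parcs D `` {v} = {}" using in_arcsD1 by auto
    then show ?thesis by simp
  qed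
  moreover obtain e where "bij_betw e (UNIV :: nat set) (pverts D)"
  proof -
    have "natLeq =o \<kappa>" using le ge by (simp add: ordIso_iff_ordLeq)
    then have "|UNIV :: nat set| =o |pverts D|"
      using ordIso_transitive[OF card_of_nat] ordIso_transitive[OF _ ordIso_symmetric[OF P]] by blast
    then show thesis using that by (auto simp flip: card_of_ordIso)
  qed
  ultimately obtain c :: "('v, 'v) cycle_seq" and D' where c: "reversal D c D'"
    and reach: "\<And>x. x \<in> pverts D \<Longrightarrow> finite ((parcs D')\<^sup>* `` {x})"
    using exists_finite_reach[OF T] by blast
  interpret D': tournament D' using reversal_parity[OF c] by blast
  have V: "pverts D' = pverts D" using reversal_parity[OF c] by blast
  have "|Field \<kappa>| =o |pverts D|"
    by (rule ordIso_transitive[OF card_of_Field_ordIso[OF co] ordIso_symmetric[OF P]])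
  then obtain e where e: "bij_betw e (Field \<kappa>) (pverts D)" by (auto simp flip: card_of_ordIso)
  define W where "W a = (\<Union>x \<in> under \<kappa> a. (parcs D')\<^sup>* `` {e x})" for a
  have eP: "e x \<in> pverts D" if "x \<in> under \<kappa> a" for x a
    using that e by (auto simp: bij_betw_def under_def Field_def)
  have "finite (under \<kappa> a)" if "a \<in> Field \<kappa>" for a
  proof -
    have "under \<kappa> a = insert a (underS \<kappa> a)" using refl[OF that] by (auto simp: under_def underS_def)
    then show ?thesis using card_of_underS[OF co that] by (simp add: fin[symmetric])
  qed
  then have "|W a| <o \<kappa>" if "a \<in> Field \<kappa>" for a
    using reach eP that unfolding fin[symmetric] W_def by blast
  moreover have "W a \<subseteq> W b" if "(a, b) \<in> \<kappa>" for a b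
    using that trans unfolding W_def under_def by blast
  moreover have "(\<Union>a \<in> Field \<kappa>. W a) = pverts D"
  proof
    have "y \<in> pverts D" if "(x, y) \<in> (parcs D')\<^sup>*" "x \<in> pverts D" for x y
      using that by induction (use V D'.in_arcsD2 in blast)+
    then show "(\<Union>a \<in> Field \<kappa>. W a) \<subseteq> pverts D" using eP unfolding W_def by blast
    show "pverts D \<subseteq> (\<Union>a \<in> Field \<kappa>. W a)"
    proof
      fix v assume "v \<in> pverts D"
      then obtain a where "a \<in> Field \<kappa>" "v = e a" using e by (auto simp: bij_betw_def)
      then show "v \<in> (\<Union>a \<in> Field \<kappa>. W a)" using refl unfolding W_def under_def by blast
    qed
  qed
  moreover have "v \<in> W a" if "u \<in> W a" "(u, v) \<in> parcs D'" for a u v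
    using that unfolding W_def by (auto intro: rtrancl_into_rtrancl)
  ultimately show ?thesis using c by blast
qed

lemma exists_downward_partition:
  fixes \<kappa> :: "'k rel" and \<mu> :: "'m rel" and D :: "'v pair_pre_digraph"
  assumes \<kappa>: "Cinfinite \<kappa>" and T: "tournament D" and P: "|pverts D| =o \<kappa>" and cf: "is_cf \<kappa> \<mu>"
    and deg: "\<forall>v \<in> pverts D. |out_nbrs D v| <o \<kappa>"
  shows "\<exists>(c :: ('v, 'v) cycle_seq) D' V. reversal D c D' \<and>
    indexed_partition (pverts D) (Field \<mu>) V \<and> (\<forall>\<xi> \<in> Field \<mu>. |V \<xi>| <o \<kappa>) \<and>
    (\<forall>\<xi> \<in> Field \<mu>. \<forall>\<zeta> \<in> underS \<mu> \<xi>. \<forall>u \<in> V \<xi>. \<forall>v \<in> V \<zeta>. (u, v) \<in> parcs D')"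
proof -
  interpret tournament D by (rule T)
  obtain c :: "('v, 'v) cycle_seq" and D' and W where c: "reversal D c D'"
    and W: "\<forall>a b. (a, b) \<in> \<kappa> \<longrightarrow> W a \<subseteq> W b" "\<forall>a \<in> Field \<kappa>. |W a| <o \<kappa>"
      "(\<Union>a \<in> Field \<kappa>. W a) = pverts D"
    and closed: "\<forall>a \<in> Field \<kappa>. \<forall>u \<in> W a. \<forall>v. (u, v) \<in> parcs D' \<longrightarrow> v \<in> W a"
    using exists_closed_chain[OF T \<kappa> P deg] by (elim exE conjE) (rule that)
  obtain V where V: "indexed_partition (pverts D) (Field \<mu>) V" "\<forall>\<xi> \<in> Field \<mu>. |V \<xi>| <o \<kappa>"
    and sep: "\<And>\<xi> \<zeta>. \<xi> \<in> Field \<mu> \<Longrightarrow> \<zeta> \<in> underS \<mu> \<xi> \<Longrightarrow> \<exists>a \<in> Field \<kappa>. V \<zeta> \<subseteq> W a \<and> V \<xi> \<inter> W a = {}"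
    using exists_partition_of_chain[OF \<kappa> cf P W(1)[rule_format] W(2)[rule_format] W(3)] by metis
  interpret D': tournament D' using reversal_parity[OF c] by blast
  have VD': "pverts D' = pverts D" using reversal_parity[OF c] by blast
  have "(u, v) \<in> parcs D'"
    if \<xi>: "\<xi> \<in> Field \<mu>" "\<zeta> \<in> underS \<mu> \<xi>" and uv: "u \<in> V \<xi>" "v \<in> V \<zeta>" for \<xi> \<zeta> u v
  proof -
    obtain a where a: "a \<in> Field \<kappa>" "v \<in> W a" "u \<notin> W a" using sep[OF \<xi>] uv by blast
    have "\<zeta> \<in> Field \<mu>" using \<xi>(2) by (auto simp: underS_def Field_def)
    then have "u \<in> pverts D" "v \<in> pverts D" using \<xi>(1) uv V(1) by (auto simp: indexed_partition_def)
    moreover have "(v, u) \<notin> parcs D'" using closed a by blast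
    moreover have "u \<noteq> v" using a by blast
    ultimately show ?thesis using D'.exactly_one_arc VD' by blast
  qed
  then show ?thesis using c V by blast
qed

theorem theorem5p3:
  fixes \<kappa> :: "'k rel" and \<mu> :: "'m rel" and D :: "'v pair_pre_digraph"
  assumes "Cinfinite \<kappa>"
    and "tournament D"
    and "|pverts D| =o \<kappa>"
    and "is_cf \<kappa> \<mu>"
  shows "((\<forall>v \<in> pverts D. |out_arcs (with_proj D) v| <o \<kappa>) \<longrightarrow>
      (\<exists>\<C> \<in> (rs D :: ('v, 'v) cycle_seq set). \<exists>V :: 'm \<Rightarrow> 'v set.
        indexed_partition (pverts D) (Field \<mu>) V \<and>
        (\<forall>\<xi> \<in> Field \<mu>. |V \<xi>| <o \<kappa>) \<and>
        (\<forall>\<xi> \<in> Field \<mu>. \<forall>\<zeta> \<in> underS \<mu> \<xi>. \<forall>u \<in> V \<xi>. \<forall>v \<in> V \<zeta>.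
          (u, v) \<in> parcs (reversed D \<C>)))) \<and>
    ((\<forall>v \<in> pverts D. |in_arcs (with_proj D) v| <o \<kappa>) \<longrightarrow>
      (\<exists>\<C> \<in> (rs D :: ('v, 'v) cycle_seq set). \<exists>V :: 'm \<Rightarrow> 'v set.
        indexed_partition (pverts D) (Field \<mu>) V \<and>
        (\<forall>\<xi> \<in> Field \<mu>. |V \<xi>| <o \<kappa>) \<and>
        (\<forall>\<xi> \<in> Field \<mu>. \<forall>\<zeta> \<in> underS \<mu> \<xi>. \<forall>v \<in> V \<xi>. \<forall>u \<in> V \<zeta>.
          (u, v) \<in> parcs (reversed D \<C>))))"
proof (intro conjI impI)
  assume deg: "\<forall>v \<in> pverts D. |out_arcs (with_proj D) v| <o \<kappa>"
  have deg': "\<forall>v \<in> pverts D. |out_nbrs D v| <o \<kappa>"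
  proof
    fix v assume v: "v \<in> pverts D"
    have "out_nbrs D v = snd ` out_arcs (with_proj D) v"
      by (force simp: out_nbrs_def out_arcs_def)
    then show "|out_nbrs D v| <o \<kappa>" using deg v card_of_image ordLeq_ordLess_trans by metis
  qed
  obtain c :: "('v, 'v) cycle_seq" and D' and V :: "'m \<Rightarrow> 'v set" where c: "reversal D c D'"
    and V: "indexed_partition (pverts D) (Field \<mu>) V" "\<forall>\<xi> \<in> Field \<mu>. |V \<xi>| <o \<kappa>"
      "\<forall>\<xi> \<in> Field \<mu>. \<forall>\<zeta> \<in> underS \<mu> \<xi>. \<forall>u \<in> V \<xi>. \<forall>v \<in> V \<zeta>. (u, v) \<in> parcs D'"
    using exists_downward_partition[OF assms deg'] by (elim exE conjE) (rule that)
  have "c \<in> rs D" "reversed D c = D'"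
    using c tournament.reversed_eq[OF assms(2) c] by (auto simp: rs_def)
  then show "\<exists>\<C> \<in> (rs D :: ('v, 'v) cycle_seq set). \<exists>V :: 'm \<Rightarrow> 'v set.
        indexed_partition (pverts D) (Field \<mu>) V \<and>
        (\<forall>\<xi> \<in> Field \<mu>. |V \<xi>| <o \<kappa>) \<and>
        (\<forall>\<xi> \<in> Field \<mu>. \<forall>\<zeta> \<in> underS \<mu> \<xi>. \<forall>u \<in> V \<xi>. \<forall>v \<in> V \<zeta>.
          (u, v) \<in> parcs (reversed D \<C>))"
    using V by (intro bexI[of _ c] exI[of _ V]) simp_all
next
  assume deg: "\<forall>v \<in> pverts D. |in_arcs (with_proj D) v| <o \<kappa>"
  have deg': "\<forall>v \<in> pverts (converse_digraph D). |out_nbrs (converse_digraph D) v| <o \<kappa>"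
  proof
    fix v assume v: "v \<in> pverts (converse_digraph D)"
    have "out_nbrs (converse_digraph D) v = fst ` in_arcs (with_proj D) v"
      by (force simp: out_nbrs_def in_arcs_def)
    then show "|out_nbrs (converse_digraph D) v| <o \<kappa>"
      using deg v card_of_image ordLeq_ordLess_trans by (metis converse_digraph_simps(1))
  qed
  have P: "|pverts (converse_digraph D)| =o \<kappa>" using assms(3) by simp
  obtain c :: "('v, 'v) cycle_seq" and D' and V :: "'m \<Rightarrow> 'v set" where c: "reversal (converse_digraph D) c D'"
    and V: "indexed_partition (pverts D) (Field \<mu>) V" "\<forall>\<xi> \<in> Field \<mu>. |V \<xi>| <o \<kappa>"
      "\<forall>\<xi> \<in> Field \<mu>. \<forall>\<zeta> \<in> underS \<mu> \<xi>. \<forall>u \<in> V \<xi>. \<forall>v \<in> V \<zeta>. (u, v) \<in> parcs D'"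
    using exists_downward_partition[OF assms(1) tournament_conv[OF assms(2)] P assms(4) deg']
    unfolding converse_digraph_simps(1) by (elim exE conjE) (rule that)
  let ?c = "(fst c, \<lambda>i. (snd c i)\<inverse>)"
  have rc: "reversal D ?c (converse_digraph D')" using reversal_conv[OF c] by simp
  then have "?c \<in> rs D" "reversed D ?c = converse_digraph D'"
    using tournament.reversed_eq[OF assms(2) rc] by (auto simp: rs_def)
  then show "\<exists>\<C> \<in> (rs D :: ('v, 'v) cycle_seq set). \<exists>V :: 'm \<Rightarrow> 'v set.
        indexed_partition (pverts D) (Field \<mu>) V \<and>
        (\<forall>\<xi> \<in> Field \<mu>. |V \<xi>| <o \<kappa>) \<and>
        (\<forall>\<xi> \<in> Field \<mu>. \<forall>\<zeta> \<in> underS \<mu> \<xi>. \<forall>v \<in> V \<xi>. \<forall>u \<in> V \<zeta>.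
          (u, v) \<in> parcs (reversed D \<C>))"
    using V by (intro bexI[of _ ?c] exI[of _ V]) simp_all
qed

end
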